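(* Let $(M,d_M)$ be a metric space which contains a thick family of geodesics. Then $(M,d_M)$ is not Markov $p$-convex for any $p\in(0,\infty)$.
   Context: Geodesics. Let $u,v$ be two elements of a metric space $(M,d_M)$. A $uv$-geodesic is a distance-preserving map $g:[0,d_M(u,v)]\to M$ with $g(0)=u$ and $g(d_M(u,v))=v$ (the interval carries the usual distance of $\mathbb{R}$). Thick family of geodesics. A nonempty family $T$ of $uv$-geodesics in $M$ (for fixed $u,v\in M$) is called thick if there is $\alpha>0$ such that for every $g\in T$ and every finite collection of points $r_1,\dots,r_n\in[0,d_M(u,v)]$ there are another $uv$-geodesic $\widetilde g\in T$ and a sequence $0<s_1<q_1<s_2<q_2<\dots<s_m<q_m<s_{m+1}<d_M(u,v)$ satisfying: (i) the set $\{0,q_1,\dots,q_m,d_M(u,v)\}$ contains $r_1,\dots,r_n$; (ii) $g(q_i)=\widetilde g(q_i)$ for $i=1,\dots,m$; (iii) $\sum_{i=1}^{m+1}d_M(g(s_i),\widetilde g(s_i))\ge\alpha$. A metric space contains a thick family of geodesics if for some $u,v$ in it there is a thick family of $uv$-geodesics. Markov convexity. Let $\{X_t\}_{t\in\mathbb{Z}}$ be a Markov chain on a state space $\Omega$. For an integer $k$, denote by $\{\widetilde X_t(k)\}_{t\in\mathbb{Z}}$ the process which equals $X_t$ for times $t\le k$, and evolves independently of $\{X_t\}$ (with respect to the same transition probabilities) for times $t>k$. Fix $p>0$. A metric space $(X,d_X)$ is called Markov $p$-convex with constant $\Pi$ if for every Markov chain $\{X_t\}_{t\in\mathbb{Z}}$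 on a state space $\Omega$ and every $f:\Omega\to X$, $$\sum_{k=0}^{\infty}\sum_{t\in\mathbb{Z}}\frac{\mathbb{E}\left[d_X\left(f(X_t),f\left(\widetilde X_t\left(t-2^{k}\right)\right)\right)^p\right]}{2^{kp}}\le\Pi^p\cdot\sum_{t\in\mathbb{Z}}\mathbb{E}\left[d_X(f(X_t),f(X_{t-1}))^p\right].$$ The least constant $\Pi$ for which this holds for all Markov chains (and all $f$) is denoted $\Pi_p(X)$ (it is $\infty$ if there is no such finite constant). $(X,d_X)$ is Markov $p$-convex if $\Pi_p(X)<\infty$. *)

theory Defs
  imports "HOL-Probability.Probability"
begin

text \<open>A map on the interval is an extensional function, so that distinct elements of a family of
  geodesics differ somewhere on the interval.\<close>

definition geodesic :: "'a set \<Rightarrow> ('a \<Rightarrow> 'a \<Rightarrow> real) \<Rightarrow> 'a \<Rightarrow> 'a \<Rightarrow> (real \<Rightarrow> 'a) \<Rightarrow> bool" where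
  "geodesic M d u v g \<longleftrightarrow>
     g \<in> {0..d u v} \<rightarrow>\<^sub>E M \<and>
     (\<forall>x\<in>{0..d u v}. \<forall>y\<in>{0..d u v}. d (g x) (g y) = \<bar>x - y\<bar>) \<and>
     g 0 = u \<and> g (d u v) = v"

text \<open>The sequences are indexed from 1, and \<open>m = 0\<close> (the single point \<open>s 1\<close>) is permitted. Demanding
  \<open>m \<ge> 1\<close> would give the same notion, since an interior point may always be added to \<open>R\<close>.\<close>

definition thick_family ::
  "'a set \<Rightarrow> ('a \<Rightarrow> 'a \<Rightarrow> real) \<Rightarrow> 'a \<Rightarrow> 'a \<Rightarrow> (real \<Rightarrow> 'a) set \<Rightarrow> bool" where
  "thick_family M d u v T \<longleftrightarrow>
     T \<noteq> {} \<and> (\<forall>g\<in>T. geodesic M d u v g) \<and>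
     (\<exists>\<alpha>>0. \<forall>g\<in>T. \<forall>R. finite R \<and> R \<subseteq> {0..d u v} \<longrightarrow>
        (\<exists>h\<in>T. h \<noteq> g \<and> (\<exists>(m::nat) (s::nat \<Rightarrow> real) (q::nat \<Rightarrow> real).
           0 < s 1 \<and> (\<forall>i\<in>{1..m}. s i < q i \<and> q i < s (i + 1)) \<and> s (m + 1) < d u v \<and>
           R \<subseteq> {0, d u v} \<union> q ` {1..m} \<and>
           (\<forall>i\<in>{1..m}. g (q i) = h (q i)) \<and>
           (\<Sum>i=1..m + 1. d (g (s i)) (h (s i))) \<ge> \<alpha>)))"

definition contains_thick_family :: "'a set \<Rightarrow> ('a \<Rightarrow> 'a \<Rightarrow> real) \<Rightarrow> bool" where
  "contains_thick_family M d \<longleftrightarrow> (\<exists>u\<in>M. \<exists>v\<in>M. \<exists>T. thick_family M d u v T)"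

text \<open>\<open>K t x\<close> is the distribution of the state at time \<open>t + 1\<close> given state \<open>x\<close> at time \<open>t\<close>; the chain
  need be neither stationary nor time-homogeneous. The last conjunct is the Markov property,
  multiplied out to avoid conditioning on null events.\<close>

definition markov_chain ::
  "'w measure \<Rightarrow> (int \<Rightarrow> 's \<Rightarrow> 's pmf) \<Rightarrow> (int \<Rightarrow> 'w \<Rightarrow> 's) \<Rightarrow> bool" where
  "markov_chain P K X \<longleftrightarrow>
     prob_space P \<and>
     (\<forall>t. X t \<in> measurable P (count_space UNIV)) \<and>
     (\<forall>a b x. a \<le> b \<longrightarrow>
        measure P {\<omega> \<in> space P. \<forall>r\<in>{a..b + 1}. X r \<omega> = x r} =
        measure P {\<omega> \<in> space P. \<forall>r\<in>{a..b}. X r \<omega> = x r} * pmf (K b (x b)) (x (b + 1)))"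

text \<open>\<open>Y\<close> is the process that agrees with \<open>X\<close> up to time \<open>k\<close> and then evolves independently of \<open>X\<close>
  with the same transition probabilities: conditionally on any stretch of the trajectory of \<open>X\<close>
  (including times after \<open>k\<close>) and on the past of \<open>Y\<close> up to time \<open>b \<ge> k\<close>, the next step of \<open>Y\<close> has
  distribution \<open>K b (Y b)\<close>. This determines the joint law of \<open>X\<close> and \<open>Y\<close>.\<close>

definition branched_process ::
  "'w measure \<Rightarrow> (int \<Rightarrow> 's \<Rightarrow> 's pmf) \<Rightarrow> (int \<Rightarrow> 'w \<Rightarrow> 's) \<Rightarrow> int \<Rightarrow> (int \<Rightarrow> 'w \<Rightarrow> 's) \<Rightarrow> bool" where
  "branched_process P K X k Y \<longleftrightarrow>
     (\<forall>t. Y t \<in> measurable P (count_space UNIV)) \<and>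
     (\<forall>t\<le>k. \<forall>\<omega>\<in>space P. Y t \<omega> = X t \<omega>) \<and>
     (\<forall>a b c x y. a \<le> k \<and> k \<le> b \<longrightarrow>
        measure P {\<omega> \<in> space P. (\<forall>r\<in>{a..c}. X r \<omega> = x r) \<and> (\<forall>r\<in>{a..b + 1}. Y r \<omega> = y r)} =
        measure P {\<omega> \<in> space P. (\<forall>r\<in>{a..c}. X r \<omega> = x r) \<and> (\<forall>r\<in>{a..b}. Y r \<omega> = y r)}
          * pmf (K b (y b)) (y (b + 1)))"

text \<open>As \<open>f\<close> is arbitrary, state spaces are discrete; a chain then visits only countably many states,
  so the state space may be taken to be \<^typ>\<open>nat\<close>. The chain together with all its branched processes
  is a countable family of discrete random variables and can be realised on a probability space
  whose points are reals, so fixing that sample type loses no generality either. All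
  expectations and sums are taken in \<^typ>\<open>ennreal\<close>.\<close>

definition markov_convex_with :: "real \<Rightarrow> real \<Rightarrow> 'a set \<Rightarrow> ('a \<Rightarrow> 'a \<Rightarrow> real) \<Rightarrow> bool" where
  "markov_convex_with C p M d \<longleftrightarrow>
     (\<forall>(P :: real measure) (K :: int \<Rightarrow> nat \<Rightarrow> nat pmf) X Y f.
        markov_chain P K X \<and> (\<forall>k. branched_process P K X k (Y k)) \<and> range f \<subseteq> M \<longrightarrow>
        (\<Sum>k. \<Sum>\<^sub>\<infinity>t. (\<integral>\<^sup>+\<omega>. ennreal (d (f (X t \<omega>)) (f (Y (t - 2 ^ k) t \<omega>)) powr p) \<partial>P)
                     / ennreal (2 powr (real k * p)))
        \<le> ennreal (C powr p) *
          (\<Sum>\<^sub>\<infinity>t. \<integral>\<^sup>+\<omega>. ennreal (d (f (X t \<omega>)) (f (X (t - 1) \<omega>)) powr p) \<partial>P))"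

definition markov_convexity_constant :: "real \<Rightarrow> 'a set \<Rightarrow> ('a \<Rightarrow> 'a \<Rightarrow> real) \<Rightarrow> ennreal" where
  "markov_convexity_constant p M d = Inf (ennreal ` {C. C \<ge> 0 \<and> markov_convex_with C p M d})"

definition markov_convex :: "real \<Rightarrow> 'a set \<Rightarrow> ('a \<Rightarrow> 'a \<Rightarrow> real) \<Rightarrow> bool" where
  "markov_convex p M d \<longleftrightarrow> markov_convexity_constant p M d < \<infinity>"

end

theory Submission
  imports Defs
begin

text \<open>Iterating thickness gives a binary tree of geodesics: the two children of a node
  agree on a finite set of points, their deviations between consecutive points add up to at least
  \<open>\<alpha>\<close>, and the meshes of the point sets shrink rapidly with the depth. A walker moves at unit
  speed and, at each branch point of depth \<open>n\<close>, resamples all choices of depth at least \<open>n\<close> by fair coins.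
  If two walkers separate before a branch point of depth \<open>n\<close>, flipping that coin of the first
  walker only moves it by the deviation of the two branches, so the expected \<open>p\<close>-th power of their
  distance is bounded below at the time scale of that depth. Distinct depths use disjoint time
  scales \<open>2 ^ k\<close> and contribute equally, so the left-hand side of the Markov convexity
  inequality grows linearly in the depth of the tree while the right-hand side does not depend on it.\<close>

section \<open>Trees of geodesics\<close>

text \<open>Thickness controls only the sum of the deviations, not where or at which scale they
  occur. The remedy is to compare a deviation with the time elapsed since the last point of
  agreement. Cells where this ratio is small carry at most half of \<alpha>; in the others it is
  bounded below by a fixed \<gamma>. If \<open>2 ^ k\<close> time steps of length \<epsilon> are
  comparable to the elapsed time, the term of the inequality is of order
  \<open>\<epsilon> powr p\<close> whatever the scale, for every p > 0. With order 1/\<epsilon> good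
  grid times, each depth yields order \<open>\<epsilon> powr p / \<epsilon>\<close>, the same order
  as the bound for the sum of one-step distances. The joint law of the two walkers is never
  computed. The flip preserves the law of the noise and is invisible to the second walker, so that
  walker is far from the first one or from its flipped version. Deeper choices blur the position of
  the first walker; small meshes keep this blur below a quarter of the least deviation counted at
  the depth in question.\<close>

lemma card_grid_in_interval:
  fixes s \<delta> \<epsilon> :: real
  assumes "0 < \<epsilon>" "\<epsilon> \<le> \<delta> / 4" "\<delta> / 4 \<le> s"
  shows "\<delta> / (4 * \<epsilon>) \<le> real (card {t::nat. \<bar>real t * \<epsilon> - s\<bar> \<le> \<delta> / 4})"
proof -
  define a b where "a = (s - \<delta> / 4) / \<epsilon>" and "b = (s + \<delta> / 4) / \<epsilon>"
  \<comment> \<open>With y = \<delta> / (4 * \<epsilon>) \<ge> 1 there are at least b - a - 1 = 2 y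
    - 1 \<ge> y grid points. Nonnegativity of \<open>a\<close> makes natural indices
    sufficient.\<close>
  have a0: "0 \<le> a" using assms by (simp add: a_def)
  have ab: "b - a = 2 * (\<delta> / (4 * \<epsilon>))" using assms by (simp add: a_def b_def field_simps)
  have ge1: "1 \<le> \<delta> / (4 * \<epsilon>)" using assms by (simp add: field_simps)
  have "{t::nat. \<bar>real t * \<epsilon> - s\<bar> \<le> \<delta> / 4} = {nat \<lceil>a\<rceil>..nat \<lfloor>b\<rfloor>}"
  proof -
    have "\<bar>real t * \<epsilon> - s\<bar> \<le> \<delta> / 4 \<longleftrightarrow> a \<le> real t \<and> real t \<le> b" for t :: nat
    proof -
      have "\<bar>real t * \<epsilon> - s\<bar> \<le> \<delta> / 4 \<longleftrightarrow>
          s - \<delta> / 4 \<le> real t * \<epsilon> \<and> real t * \<epsilon> \<le> s + \<delta> / 4"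
        by (rule abs_diff_le_iff)
      then show ?thesis
        using assms(1) unfolding a_def b_def by (simp only: pos_divide_le_eq pos_le_divide_eq)
    qed
    moreover have "a \<le> real t \<longleftrightarrow> nat \<lceil>a\<rceil> \<le> t" for t :: nat
      by (simp add: nat_le_iff ceiling_le_iff)
    moreover have "real t \<le> b \<longleftrightarrow> t \<le> nat \<lfloor>b\<rfloor>" for t :: nat
    proof -
      have "0 \<le> b" using a0 ab ge1 by simp
      then have "real (nat \<lfloor>b\<rfloor>) \<le> b" by (rule of_nat_floor)
      then show ?thesis using le_nat_floor[of t b] by (meson of_nat_mono order_trans)
    qed
    ultimately show ?thesis by (intro set_eqI) (simp only: mem_Collect_eq atLeastAtMost_iff)
  qed
  moreover have "real (card {nat \<lceil>a\<rceil>..nat \<lfloor>b\<rfloor>}) \<ge> b - a - 1"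
  proof -
    have "real (nat \<lceil>a\<rceil>) < a + 1"
      using a0 ceiling_correct[of a] by (simp add: of_nat_nat)
    moreover have "b < real (nat \<lfloor>b\<rfloor>) + 1"
      using a0 ab ge1 floor_correct[of b] by (simp add: of_nat_nat)
    moreover have "real (nat \<lfloor>b\<rfloor>) + 1 \<le> real (Suc (nat \<lfloor>b\<rfloor>) - nat \<lceil>a\<rceil>) + real (nat \<lceil>a\<rceil>)"
      by (simp flip: of_nat_add of_nat_Suc)
    ultimately show ?thesis by simp
  qed
  ultimately show ?thesis using ab ge1 by simp
qed

text \<open>The deviation at \<open>x\<close> is measured relative to the time \<open>x - q\<close> elapsed since the last branch
  point \<open>q\<close>.\<close>

definition deviates ::
  "('a \<Rightarrow> 'a \<Rightarrow> real) \<Rightarrow> real \<Rightarrow> real \<Rightarrow> real set \<Rightarrow> (real \<Rightarrow> 'a) \<Rightarrow> (real \<Rightarrow> 'a) \<Rightarrow> real \<Rightarrow> bool" where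
  "deviates d \<gamma> lo Q g h x \<longleftrightarrow>
     (\<exists>q\<in>Q. q < x \<and> Q \<inter> {q<..x} = {} \<and> lo \<le> x - q \<and> \<gamma> * (x - q) \<le> d (g x) (h x))"

section \<open>Two geodesics that agree at finitely many points\<close>

context Metric_space
begin

lemma geodesic_in: "geodesic M d u v g \<Longrightarrow> x \<in> {0..d u v} \<Longrightarrow> g x \<in> M"
  by (auto simp: geodesic_def)

lemma geodesic_dist:
  "geodesic M d u v g \<Longrightarrow> x \<in> {0..d u v} \<Longrightarrow> y \<in> {0..d u v} \<Longrightarrow> d (g x) (g y) = \<bar>x - y\<bar>"
  by (auto simp: geodesic_def)

lemma geodesics_dist_le:
  assumes "geodesic M d u v g" "geodesic M d u v h" "x \<in> {0..d u v}" "q \<in> {0..d u v}" "g q = h q"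
  shows "d (g x) (h x) \<le> 2 * \<bar>x - q\<bar>"
proof -
  have "d (g x) (h x) \<le> d (g x) (g q) + d (h q) (h x)"
    using triangle[of "g x" "g q" "h x"] assms geodesic_in by metis
  then show ?thesis using geodesic_dist[OF assms(1,3,4)] geodesic_dist[OF assms(2,4,3)]
    by (simp add: abs_minus_commute)
qed

lemma geodesics_dist_lipschitz:
  assumes g: "geodesic M d u v g" and h: "geodesic M d u v h" and x: "x \<in> {0..d u v}" and y: "y \<in> {0..d u v}"
  shows "d (g y) (h y) - 2 * \<bar>x - y\<bar> \<le> d (g x) (h x)"
proof -
  note M = geodesic_in[OF g x] geodesic_in[OF g y] geodesic_in[OF h x] geodesic_in[OF h y]
  have "d (g y) (h y) \<le> d (g y) (g x) + d (g x) (h x) + d (h x) (h y)"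
    using triangle[of "g y" "g x" "h y"] triangle[of "g x" "h x" "h y"] M by linarith
  then show ?thesis using geodesic_dist[OF g y x] geodesic_dist[OF h x y]
    by (simp add: abs_minus_commute)
qed

text \<open>Call a cell between consecutive agreement points good if its deviation is at least
  \<beta> times its length. Bad cells lose at most \<beta> D = \<alpha> / 2. In a good cell the
  Lipschitz bound spreads the deviation at \<open>s i\<close> over a window containing at least
  \<open>\<delta> i / (4 * \<epsilon>)\<close> grid points, whence the total \<alpha> / 8 /
  \<epsilon>.\<close>

lemma thick_branch:
  assumes T: "\<forall>g\<in>T. geodesic M d u v g" and \<alpha>: "0 < \<alpha>" and D: "0 < d u v"
    and g: "g \<in> T" and h: "h \<in> T"
    and s1: "0 < s 1" and sq: "\<forall>i\<in>{1..m}. s i < q i \<and> q i < s (i + 1)"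
    and sm: "s (m + 1) < d u v"
    and agree: "\<forall>i\<in>{1..m}. g (q i) = h (q i)"
    and sum: "(\<Sum>i=1..m + 1. d (g (s i)) (h (s i))) \<ge> \<alpha>"
  defines "Q \<equiv> insert 0 (q ` {1..m::nat})"
  shows "\<exists>lo>0. \<forall>\<epsilon>. 0 < \<epsilon> \<and> \<epsilon> \<le> lo \<longrightarrow>
    \<alpha> / 8 / \<epsilon> \<le> real (card {t::nat. real t * \<epsilon> < d u v \<and>
      deviates d (\<alpha> / (4 * d u v)) lo Q g h (real t * \<epsilon>)})"
    and "Q \<subseteq> {0..<d u v}"
    and "\<forall>x\<in>Q. g x = h x"
proof -
  define D where "D = d u v"
  have D0: "0 < D" using D D_def by simp
  have gg: "geodesic M d u v g" and hh: "geodesic M d u v h" using T g h by auto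
  \<comment> \<open>Adding both end points treats all m + 1 cells alike, also when m = 0.\<close>
  define qq where "qq i = (if i = 0 then 0 else if i = m + 1 then D else q i)" for i
  have s_gt: "qq (i - 1) < s i" if i: "i \<in> {1..m+1}" for i
  proof (cases "i = 1")
    case True then show ?thesis using s1 by (simp add: qq_def)
  next
    case False
    then obtain j where "i = Suc j" using i by (cases i) auto
    with False i have "i = j + 1" "j \<in> {1..m}" by auto
    then show ?thesis using sq by (auto simp: qq_def)
  qed
  have s_lt: "s i < qq i" if "i \<in> {1..m+1}" for i
    using that sq sm by (cases "i = m + 1") (auto simp: qq_def D_def)
  have qq_step: "qq i < qq (Suc i)" if "i \<le> m" for i
    using s_gt[of "Suc i"] s_lt[of "Suc i"] that by simp
  have qq_mono: "qq i \<le> qq j" if "i \<le> j" "j \<le> m + 1" for i j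
    using that
  proof (induction j rule: dec_induct)
    case (step n) then show ?case using qq_step[of n] by auto
  qed simp
  have qq0: "qq 0 = 0" "qq (m + 1) = D" by (auto simp: qq_def)
  have qq_bd: "0 \<le> qq i" "qq i \<le> D" if "i \<le> m + 1" for i
    using qq_mono[of 0 i] qq_mono[of i "m+1"] that qq0 by auto
  have qq_lt: "qq i < D" if "i \<le> m" for i
    using qq_step[OF that] qq_bd[of "Suc i"] that by auto
  have Q_eq: "Q = qq ` {0..m}"
  proof -
    have "{0..m} = insert 0 {1..m}" by auto
    moreover have "q ` {1..m} = qq ` {1..m}" by (rule image_cong) (auto simp: qq_def)
    ultimately show ?thesis unfolding Q_def by (simp add: qq0)
  qed
  show "Q \<subseteq> {0..<d u v}" using qq_bd qq_lt unfolding Q_eq D_def[symmetric] by auto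
  show Qagree: "\<forall>x\<in>Q. g x = h x"
    using agree gg hh unfolding Q_def geodesic_def by auto
  have qq_agree: "g (qq i) = h (qq i)" if "i \<le> m + 1" for i
  proof (cases "i = m + 1")
    case True
    then show ?thesis using gg hh by (simp add: qq_def D_def geodesic_def)
  next
    case False
    then show ?thesis using that Qagree by (simp add: Q_eq)
  qed
  define \<delta> where "\<delta> i = d (g (s i)) (h (s i))" for i
  define len where "len i = qq i - qq (i - 1)" for i
  define \<beta> where "\<beta> = \<alpha> / (2 * D)"
  have \<beta>: "\<beta> > 0" using \<alpha> D0 by (simp add: \<beta>_def)
  have len: "len i > 0" if "i \<in> {1..m+1}" for i
    using qq_step[of "i - 1"] that by (auto simp: len_def)
  have s_D: "s i \<in> {0..D}" if "i \<in> {1..m+1}" for i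
  proof -
    have "0 \<le> qq (i - 1)" "qq i \<le> D" using qq_bd that by auto
    then show ?thesis using s_gt[OF that] s_lt[OF that] by simp
  qed
  have \<delta>1: "\<delta> i \<le> 2 * (s i - qq (i - 1))" if "i \<in> {1..m+1}" for i
    using geodesics_dist_le[OF gg hh, of "s i" "qq (i-1)"] s_D[OF that] s_gt[OF that]
      qq_agree[of "i-1"] qq_bd[of "i-1"] that unfolding \<delta>_def D_def by auto
  have \<delta>2: "\<delta> i \<le> 2 * (qq i - s i)" if "i \<in> {1..m+1}" for i
    using geodesics_dist_le[OF gg hh, of "s i" "qq i"] s_D[OF that] s_lt[OF that]
      qq_agree[of "i"] qq_bd[of "i"] that unfolding \<delta>_def D_def by auto
  define I where "I = {i \<in> {1..m+1}. \<beta> * len i \<le> \<delta> i}"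
  have finI: "finite I" by (simp add: I_def)
  have sumlen: "(\<Sum>i=1..m+1. len i) = D"
  proof -
    have "(\<Sum>i=1..m+1. len i) = (\<Sum>i\<in>{0..m}. qq (Suc i) - qq i)"
      by (rule sum.reindex_bij_witness[of _ Suc "\<lambda>i. i - 1"]) (auto simp: len_def)
    also have "\<dots> = D" using sum_Suc_diff[of 0 m qq] qq0 by simp
    finally show ?thesis .
  qed
  have sumI: "\<alpha> / 2 \<le> (\<Sum>i\<in>I. \<delta> i)"
  proof -
    have "\<alpha> \<le> (\<Sum>i\<in>{1..m+1}. \<delta> i)" using sum by (simp add: \<delta>_def)
    also have "\<dots> = (\<Sum>i\<in>I. \<delta> i) + (\<Sum>i\<in>{1..m+1} - I. \<delta> i)"
      by (subst sum.subset_diff[of I]) (auto simp: I_def)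
    also have "(\<Sum>i\<in>{1..m+1} - I. \<delta> i) \<le> (\<Sum>i\<in>{1..m+1} - I. \<beta> * len i)"
      by (rule sum_mono) (auto simp: I_def)
    also have "\<dots> \<le> (\<Sum>i\<in>{1..m+1}. \<beta> * len i)"
      using \<beta> len by (intro sum_mono2) (simp_all add: less_imp_le I_def)
    also have "\<dots> = \<beta> * D" by (simp only: sum_distrib_left[symmetric] sumlen)
    also have "\<dots> = \<alpha> / 2" using D0 by (simp add: \<beta>_def)
    finally show ?thesis by simp
  qed
  \<comment> \<open>In a good cell this is at most \<open>\<delta> i / 4\<close>. That is both a
    lower bound for the time elapsed since the cell began, throughout the window, and the largest
    grid step allowed by \<open>card_grid_in_interval\<close>.\<close>
  define lo where "lo = Min ((\<lambda>i. \<beta> * len i / 4) ` {1..m+1})"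
  have lo0: "lo > 0" unfolding lo_def using \<beta> len by (subst Min_gr_iff) auto
  have lo_le: "lo \<le> \<beta> * len i / 4" if "i \<in> {1..m+1}" for i
    unfolding lo_def using that by (intro Min_le) auto
  \<comment> \<open>The window stays inside the cell because \<open>\<delta> i\<close> is at most
    twice the distance from \<open>s i\<close> to either end. The deviation drops by at most
    \<open>2 * \<delta> i / 4\<close> there, so half of it survives; this halves \<beta> to \<alpha>
    / (4 * D).\<close>
  have good: "x < D \<and> deviates d (\<alpha> / (4 * D)) lo Q g h x \<and> qq (i - 1) < x \<and> x < qq i"
    if i: "i \<in> I" and x: "\<bar>x - s i\<bar> \<le> \<delta> i / 4" for i x
  proof -
    have i': "i \<in> {1..m+1}" and \<delta>i: "\<beta> * len i \<le> \<delta> i" using i by (auto simp: I_def)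
    have \<delta>pos: "0 < \<delta> i" using \<delta>i mult_pos_pos[OF \<beta> len[OF i']] by linarith
    have xs: "x - s i \<le> \<delta> i / 4" "s i - x \<le> \<delta> i / 4"
      using abs_le_iff[THEN iffD1, OF x] by linarith+
    have x1: "\<delta> i / 4 \<le> x - qq (i - 1)" using \<delta>1[OF i'] xs by simp
    have x2: "x < qq i" using \<delta>2[OF i'] xs \<delta>pos by simp
    have xD: "x < D" using x2 qq_bd(2)[of i] i' by auto
    have "0 \<le> qq (i - 1)" using qq_bd(1) i' by auto
    then have x0: "0 \<le> x" using x1 \<delta>pos by simp
    have "d (g (s i)) (h (s i)) - 2 * \<bar>x - s i\<bar> \<le> d (g x) (h x)"
      using geodesics_dist_lipschitz[OF gg hh, of x "s i"] s_D[OF i'] x0 xD by (auto simp: D_def)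
    then have "\<delta> i / 2 \<le> d (g x) (h x)" using x unfolding \<delta>_def by simp
    moreover have "\<alpha> / (4 * D) * (x - qq (i - 1)) \<le> \<delta> i / 2"
    proof -
      have "\<beta> * (x - qq (i - 1)) \<le> \<beta> * len i" using x2 \<beta> by (simp add: len_def)
      also note \<delta>i
      finally show ?thesis by (simp add: \<beta>_def)
    qed
    ultimately have dev: "\<alpha> / (4 * D) * (x - qq (i - 1)) \<le> d (g x) (h x)" by linarith
    have empty: "Q \<inter> {qq (i - 1)<..x} = {}"
    proof -
      have False if "j \<le> m" "qq (i - 1) < qq j" "qq j \<le> x" for j
      proof (cases "j \<le> i - 1")
        case True
        moreover have "i - 1 \<le> m + 1" using i' by auto
        ultimately show False using qq_mono[of j "i - 1"] that by simp
      next
        case False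
        then have "i \<le> j" "j \<le> m + 1" using that i' by auto
        then show False using qq_mono[of i j] that x2 by simp
      qed
      then show ?thesis unfolding Q_eq by auto
    qed
    have "lo \<le> x - qq (i - 1)" using lo_le[OF i'] \<delta>i x1 by simp
    moreover have "qq (i - 1) \<in> Q" using i' by (auto simp: Q_eq)
    moreover have "qq (i - 1) < x" using x1 \<delta>pos by linarith
    ultimately show ?thesis using dev empty x2 xD unfolding deviates_def by blast
  qed
  have "\<alpha> / 8 / \<epsilon> \<le> real (card {t::nat. real t * \<epsilon> < D \<and>
      deviates d (\<alpha> / (4 * D)) lo Q g h (real t * \<epsilon>)})" (is "_ \<le> real (card ?G)")
    if \<epsilon>: "0 < \<epsilon>" "\<epsilon> \<le> lo" for \<epsilon>
  proof -
    define W where "W i = {t::nat. \<bar>real t * \<epsilon> - s i\<bar> \<le> \<delta> i / 4}" for i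
    have finG: "finite ?G"
    proof (rule finite_subset)
      show "?G \<subseteq> {..nat \<lceil>D / \<epsilon>\<rceil>}"
      proof
        fix t assume "t \<in> ?G"
        then have "real t < D / \<epsilon>" using \<epsilon> by (simp add: pos_less_divide_eq)
        also have "\<dots> \<le> real (nat \<lceil>D / \<epsilon>\<rceil>)" by (rule real_nat_ceiling_ge)
        finally show "t \<in> {..nat \<lceil>D / \<epsilon>\<rceil>}" by simp
      qed
    qed simp
    have sub: "(\<Union>i\<in>I. W i) \<subseteq> ?G" using good by (auto simp: W_def)
    have finW: "finite (W i)" if "i \<in> I" for i using that sub finG by (meson UN_upper finite_subset)
    have disj: "W i \<inter> W j = {}" if ij: "i \<in> I" "j \<in> I" "i < j" for i j
    proof -
      have False if t: "t \<in> W i" "t \<in> W j" for t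
      proof -
        have "real t * \<epsilon> < qq i" "qq (j - 1) < real t * \<epsilon>"
          using good[OF ij(1), of "real t * \<epsilon>"] good[OF ij(2), of "real t * \<epsilon>"] t by (auto simp: W_def)
        moreover have "qq i \<le> qq (j - 1)" using ij by (intro qq_mono) (auto simp: I_def)
        ultimately show False by linarith
      qed
      then show ?thesis by auto
    qed
    have "\<alpha> / 8 / \<epsilon> \<le> (\<Sum>i\<in>I. \<delta> i) / 4 / \<epsilon>" using sumI \<epsilon> by (simp add: field_simps)
    also have "\<dots> = (\<Sum>i\<in>I. \<delta> i / (4 * \<epsilon>))" by (simp add: sum_divide_distrib)
    also have "\<dots> \<le> (\<Sum>i\<in>I. real (card (W i)))"
    proof (rule sum_mono)
      fix i assume i: "i \<in> I"
      then have i': "i \<in> {1..m+1}" "\<beta> * len i \<le> \<delta> i" by (auto simp: I_def)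
      have "\<epsilon> \<le> \<delta> i / 4" using \<epsilon> lo_le[OF i'(1)] i' by linarith
      moreover have "0 \<le> qq (i - 1)" using qq_bd(1) i'(1) by auto
      then have "\<delta> i / 4 \<le> s i" using \<delta>1[OF i'(1)] s_D[OF i'(1)] by simp
      ultimately show "\<delta> i / (4 * \<epsilon>) \<le> real (card (W i))"
        unfolding W_def using \<epsilon> by (intro card_grid_in_interval) auto
    qed
    also have "\<dots> = real (card (\<Union>i\<in>I. W i))"
    proof -
      have "\<forall>i\<in>I. \<forall>j\<in>I. i \<noteq> j \<longrightarrow> W i \<inter> W j = {}"
        using disj by (metis Int_commute linorder_neqE_nat)
      then show ?thesis using finW finI by (simp add: card_UN_disjoint)
    qed
    also have "\<dots> \<le> real (card ?G)" using card_mono[OF finG sub] by simp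
    finally show ?thesis .
  qed
  then show "\<exists>lo>0. \<forall>\<epsilon>. 0 < \<epsilon> \<and> \<epsilon> \<le> lo \<longrightarrow>
    \<alpha> / 8 / \<epsilon> \<le> real (card {t::nat. real t * \<epsilon> < d u v \<and>
      deviates d (\<alpha> / (4 * d u v)) lo Q g h (real t * \<epsilon>)})"
    using lo0 unfolding D_def by blast
qed

end

text \<open>A set \<open>\<sigma> \<subseteq> {..<n}\<close> is read as a binary word of length \<open>n\<close>, so \<open>g \<sigma>\<close> is the geodesic at a node of
  depth \<open>n\<close>; its two children are \<open>g \<sigma>\<close> itself and \<open>g (insert n \<sigma>)\<close>, which agree on \<open>Q n \<sigma>\<close>.\<close>

locale geodesic_tree = Metric_space M d for M :: "'a set" and d +
  fixes u v :: 'a and \<gamma> c :: real and L :: nat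
    and g :: "nat set \<Rightarrow> real \<Rightarrow> 'a" and Q :: "nat \<Rightarrow> nat set \<Rightarrow> real set"
    and lo mesh :: "nat \<Rightarrow> real"
  assumes D_pos: "0 < d u v"
    and \<gamma>_pos: "0 < \<gamma>"
    and geodesic_g: "\<sigma> \<subseteq> {..<L} \<Longrightarrow> geodesic M d u v (g \<sigma>)"
    and Q_subset: "n < L \<Longrightarrow> \<sigma> \<subseteq> {..<n} \<Longrightarrow> Q n \<sigma> \<subseteq> {0..<d u v}"
    and Q_0: "n < L \<Longrightarrow> \<sigma> \<subseteq> {..<n} \<Longrightarrow> 0 \<in> Q n \<sigma>"
    and g_agree: "n < L \<Longrightarrow> \<sigma> \<subseteq> {..<n} \<Longrightarrow> x \<in> Q n \<sigma> \<Longrightarrow> g (insert n \<sigma>) x = g \<sigma> x"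
    and Q_Suc: "Suc n < L \<Longrightarrow> \<sigma> \<subseteq> {..<Suc n} \<Longrightarrow> Q n (\<sigma> \<inter> {..<n}) \<subseteq> Q (Suc n) \<sigma>"
    and Q_mesh: "n < L \<Longrightarrow> \<sigma> \<subseteq> {..<n} \<Longrightarrow> x \<in> {0..<d u v} \<Longrightarrow> \<exists>q\<in>Q n \<sigma>. q \<le> x \<and> x - q \<le> mesh n"
    and lo_pos: "n < L \<Longrightarrow> 0 < lo n"
    and mesh_lo: "m < n \<Longrightarrow> n < L \<Longrightarrow> 4 * mesh n < lo m"
    and mesh_lo_\<gamma>: "m < n \<Longrightarrow> n < L \<Longrightarrow> 8 * mesh n \<le> \<gamma> * lo m"
    and card_deviates: "n < L \<Longrightarrow> \<sigma> \<subseteq> {..<n} \<Longrightarrow> 0 < \<epsilon> \<Longrightarrow> \<epsilon> \<le> lo n \<Longrightarrow>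
      c / \<epsilon> \<le> real (card {t::nat. real t * \<epsilon> < d u v \<and>
        deviates d \<gamma> (lo n) (Q n \<sigma>) (g \<sigma>) (g (insert n \<sigma>)) (real t * \<epsilon>)})"

section \<open>Building the tree by repeated branching\<close>

lemma deviates_mono: "deviates d \<gamma> lo Q g h x \<Longrightarrow> lo' \<le> lo \<Longrightarrow> deviates d \<gamma> lo' Q g h x"
  unfolding deviates_def by (meson order_trans)

lemma grid_mesh:
  fixes D \<mu> :: real
  assumes "0 < \<mu>"
  obtains R where "finite R" "R \<subseteq> {0..<D}" "\<And>x. x \<in> {0..<D} \<Longrightarrow> \<exists>q\<in>R. q \<le> x \<and> x - q \<le> \<mu>"
proof -
  define R where "R = {0..<D} \<inter> (\<lambda>j. real j * \<mu>) ` {..nat \<lceil>D / \<mu>\<rceil>}"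
  have "\<exists>q\<in>R. q \<le> x \<and> x - q \<le> \<mu>" if x: "x \<in> {0..<D}" for x
  proof -
    define j where "j = nat \<lfloor>x / \<mu>\<rfloor>"
    have j: "real j \<le> x / \<mu>" "x / \<mu> < real j + 1"
      using x assms floor_correct[of "x / \<mu>"] by (simp_all add: j_def)
    then have j': "real j * \<mu> \<le> x" "x \<le> real j * \<mu> + \<mu>"
      using assms by (simp_all add: pos_le_divide_eq pos_divide_less_eq distrib_right)
    have "x / \<mu> \<le> D / \<mu>" using x assms by (simp add: divide_right_mono)
    then have "real j \<le> real (nat \<lceil>D / \<mu>\<rceil>)" using j real_nat_ceiling_ge[of "D / \<mu>"] by linarith
    then have "real j * \<mu> \<in> R" using j' x assms by (auto simp: R_def)
    then show ?thesis using j' by (intro bexI[of _ "real j * \<mu>"]) auto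
  qed
  then show ?thesis using that[of R] by (auto simp: R_def)
qed

context Metric_space
begin

lemma thick_family_branch:
  assumes "thick_family M d u v T"
  obtains \<alpha> where "0 < \<alpha>" "0 < d u v"
    "\<And>g R. g \<in> T \<Longrightarrow> finite R \<Longrightarrow> R \<subseteq> {0..<d u v} \<Longrightarrow>
      \<exists>h Q lo. h \<in> T \<and> finite Q \<and> R \<subseteq> Q \<and> 0 \<in> Q \<and> Q \<subseteq> {0..<d u v} \<and> (\<forall>x\<in>Q. h x = g x) \<and> 0 < lo \<and>
        (\<forall>\<epsilon>. 0 < \<epsilon> \<and> \<epsilon> \<le> lo \<longrightarrow> \<alpha> / 8 / \<epsilon> \<le> real (card {t::nat. real t * \<epsilon> < d u v \<and>
          deviates d (\<alpha> / (4 * d u v)) lo Q g h (real t * \<epsilon>)}))"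
proof -
  have T: "\<forall>g\<in>T. geodesic M d u v g" "T \<noteq> {}" using assms by (auto simp: thick_family_def)
  obtain \<alpha> where \<alpha>: "0 < \<alpha>" and thick: "\<forall>g\<in>T. \<forall>R. finite R \<and> R \<subseteq> {0..d u v} \<longrightarrow>
        (\<exists>h\<in>T. h \<noteq> g \<and> (\<exists>(m::nat) (s::nat \<Rightarrow> real) (q::nat \<Rightarrow> real).
           0 < s 1 \<and> (\<forall>i\<in>{1..m}. s i < q i \<and> q i < s (i + 1)) \<and> s (m + 1) < d u v \<and>
           R \<subseteq> {0, d u v} \<union> q ` {1..m} \<and>
           (\<forall>i\<in>{1..m}. g (q i) = h (q i)) \<and>
           (\<Sum>i=1..m + 1. d (g (s i)) (h (s i))) \<ge> \<alpha>))"
    using assms unfolding thick_family_def by (elim conjE exE) (rule that)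
  \<comment> \<open>Even for empty \<open>R\<close>, thickness supplies points \<open>s i\<close>
    strictly between 0 and \<open>d u v\<close>.\<close>
  have D: "0 < d u v"
  proof -
    obtain g0 where "g0 \<in> T" using T by auto
    then obtain m :: nat and s q :: "nat \<Rightarrow> real" where s: "0 < s 1" "s (m + 1) < d u v"
      and sq: "\<forall>i\<in>{1..m}. s i < q i \<and> q i < s (i + 1)"
      using thick[rule_format, of g0 "{}"] by blast
    have "0 < s (Suc i)" if "i \<le> m" for i
      using that
    proof (induction i)
      case (Suc i)
      then show ?case using sq[rule_format, of "Suc i"] by simp
    qed (use s in simp)
    then show ?thesis using s(2) by fastforce
  qed
  show ?thesis
  proof (rule that[OF \<alpha> D])
    fix g R assume g: "g \<in> T" and R: "finite R" "R \<subseteq> {0..<d u v}"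
    have R': "R \<subseteq> {0..d u v}" using R by fastforce
    obtain h m s q where h: "h \<in> T" and *: "0 < s 1" "\<forall>i\<in>{1..m::nat}. s i < q i \<and> q i < s (i + 1)"
        "s (m + 1) < d u v" "\<forall>i\<in>{1..m}. g (q i) = h (q i)"
        "(\<Sum>i=1..m + 1. d (g (s i)) (h (s i))) \<ge> \<alpha>" and sub: "R \<subseteq> {0, d u v} \<union> q ` {1..m}"
      using thick[rule_format, OF g conjI[OF R(1) R']] by (elim bexE conjE exE) (rule that; assumption)
    note b = thick_branch[OF T(1) \<alpha> D g h *]
    have "R \<subseteq> insert 0 (q ` {1..m})" using sub R(2) by auto
    then show "\<exists>h Q lo. h \<in> T \<and> finite Q \<and> R \<subseteq> Q \<and> 0 \<in> Q \<and> Q \<subseteq> {0..<d u v} \<and> (\<forall>x\<in>Q. h x = g x) \<and> 0 < lo \<and>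
        (\<forall>\<epsilon>. 0 < \<epsilon> \<and> \<epsilon> \<le> lo \<longrightarrow> \<alpha> / 8 / \<epsilon> \<le> real (card {t::nat. real t * \<epsilon> < d u v \<and>
          deviates d (\<alpha> / (4 * d u v)) lo Q g h (real t * \<epsilon>)}))"
      using b h by (intro exI[of _ h] exI[of _ "insert 0 (q ` {1..m})"]) auto
  qed
qed

text \<open>Every branching uses the same \<alpha>, so \<gamma> and \<open>c\<close> do not depend
  on the depth \<open>L\<close>. Thickness applies only to members of \<open>T\<close> and finite
  sets, so the induction also carries membership in \<open>T\<close> and finiteness of the agreement
  sets. A level has finitely many nodes, so one positive threshold \<open>lo'\<close> serves all of
  them.\<close>

lemma geodesic_tree_exists:
  assumes "thick_family M d u v T"
  obtains \<gamma> c where "0 < \<gamma>" "0 < c" "\<And>L. \<exists>g Q lo mesh. geodesic_tree M d u v \<gamma> c L g Q lo mesh"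
proof -
  have T: "\<forall>g\<in>T. geodesic M d u v g" "T \<noteq> {}" using assms by (auto simp: thick_family_def)
  obtain \<alpha> where \<alpha>: "0 < \<alpha>" and D: "0 < d u v" and
    branch: "\<And>g R. g \<in> T \<Longrightarrow> finite R \<Longrightarrow> R \<subseteq> {0..<d u v} \<Longrightarrow>
      \<exists>h Q lo. h \<in> T \<and> finite Q \<and> R \<subseteq> Q \<and> 0 \<in> Q \<and> Q \<subseteq> {0..<d u v} \<and> (\<forall>x\<in>Q. h x = g x) \<and> 0 < lo \<and>
        (\<forall>\<epsilon>. 0 < \<epsilon> \<and> \<epsilon> \<le> lo \<longrightarrow> \<alpha> / 8 / \<epsilon> \<le> real (card {t::nat. real t * \<epsilon> < d u v \<and>
          deviates d (\<alpha> / (4 * d u v)) lo Q g h (real t * \<epsilon>)}))"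
  proof (rule thick_family_branch[OF assms], goal_cases)
    case (1 \<alpha>)
    from 1(2-) show ?case by (rule 1(1))
  qed
  define \<gamma> c where "\<gamma> = \<alpha> / (4 * d u v)" and "c = \<alpha> / 8"
  have pos: "0 < \<gamma>" "0 < c" using \<alpha> D by (auto simp: \<gamma>_def c_def)
  have "\<exists>g Q lo mesh. geodesic_tree M d u v \<gamma> c L g Q lo mesh \<and> (\<forall>\<sigma>\<subseteq>{..<L}. g \<sigma> \<in> T) \<and>
    (\<forall>n<L. \<forall>\<sigma>\<subseteq>{..<n}. finite (Q n \<sigma>))" for L
  proof (induction L)
    case 0
    obtain g0 where g0: "g0 \<in> T" using T by auto
    have "geodesic_tree M d u v \<gamma> c 0 (\<lambda>_. g0) Q lo mesh" for Q lo mesh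
      using D pos g0 T by unfold_locales auto
    then show ?case using g0 by (intro exI[of _ "\<lambda>_. g0"]) auto
  next
    case (Suc L)
    then obtain g Q lo mesh where tree: "geodesic_tree M d u v \<gamma> c L g Q lo mesh"
      and gT': "\<forall>\<sigma>\<subseteq>{..<L}. g \<sigma> \<in> T"
      and Qfin': "\<forall>n<L. \<forall>\<sigma>\<subseteq>{..<n}. finite (Q n \<sigma>)" by (elim exE conjE) (rule that)
    note gT = gT'[rule_format] and Qfin = Qfin'[rule_format]
    interpret geodesic_tree M d u v \<gamma> c L g Q lo mesh by (rule tree)
    \<comment> \<open>The factor \<open>min 1 \<gamma>\<close> serves \<open>mesh_lo\<close> and
      \<open>mesh_lo_\<gamma>\<close> at once; the inserted 1 covers L = 0.\<close>
    define \<mu> where "\<mu> = Min (insert 1 ((\<lambda>m. min 1 \<gamma> * lo m / 8) ` {..<L}))"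
    have \<mu>: "0 < \<mu>" unfolding \<mu>_def using lo_pos pos by (subst Min_gr_iff) auto
    have \<mu>_lo: "\<mu> \<le> min 1 \<gamma> * lo m / 8" if "m < L" for m
      unfolding \<mu>_def using that by (intro Min_le) auto
    obtain G where G: "finite G" "G \<subseteq> {0..<d u v}"
      "\<And>x. x \<in> {0..<d u v} \<Longrightarrow> \<exists>q\<in>G. q \<le> x \<and> x - q \<le> \<mu>" using grid_mesh[OF \<mu>] by metis
    \<comment> \<open>The grid \<open>G\<close> enforces the new mesh, and the points of the parent
      make the agreement sets grow along each branch.\<close>
    define R where "R \<sigma> = G \<union> (if L = 0 then {} else Q (L - 1) (\<sigma> \<inter> {..<L - 1}))" for \<sigma>
    have R: "finite (R \<sigma>)" "R \<sigma> \<subseteq> {0..<d u v}" for \<sigma>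
      using G Qfin[of "L - 1" "\<sigma> \<inter> {..<L - 1}"] Q_subset[of "L - 1" "\<sigma> \<inter> {..<L - 1}"]
      unfolding R_def by auto
    have "\<forall>\<sigma>\<in>{\<sigma>. \<sigma> \<subseteq> {..<L}}. \<exists>h P l. h \<in> T \<and> finite P \<and> R \<sigma> \<subseteq> P \<and> 0 \<in> P \<and> P \<subseteq> {0..<d u v} \<and>
        (\<forall>x\<in>P. h x = g \<sigma> x) \<and> 0 < l \<and>
        (\<forall>\<epsilon>. 0 < \<epsilon> \<and> \<epsilon> \<le> l \<longrightarrow> c / \<epsilon> \<le> real (card {t::nat. real t * \<epsilon> < d u v \<and>
          deviates d \<gamma> l P (g \<sigma>) h (real t * \<epsilon>)}))" (is "\<forall>\<sigma>\<in>_. ?B \<sigma>")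
    proof
      fix \<sigma> assume "\<sigma> \<in> {\<sigma>. \<sigma> \<subseteq> {..<L}}"
      then have "g \<sigma> \<in> T" using gT by simp
      from branch[OF this R[of \<sigma>]] show "?B \<sigma>" unfolding \<gamma>_def c_def .
    qed
    then obtain h P l where "\<forall>\<sigma>\<in>{\<sigma>. \<sigma> \<subseteq> {..<L}}. h \<sigma> \<in> T \<and> finite (P \<sigma>) \<and> R \<sigma> \<subseteq> P \<sigma> \<and> 0 \<in> P \<sigma> \<and>
        P \<sigma> \<subseteq> {0..<d u v} \<and> (\<forall>x\<in>P \<sigma>. h \<sigma> x = g \<sigma> x) \<and> 0 < l \<sigma> \<and>
        (\<forall>\<epsilon>. 0 < \<epsilon> \<and> \<epsilon> \<le> l \<sigma> \<longrightarrow> c / \<epsilon> \<le> real (card {t::nat. real t * \<epsilon> < d u v \<and>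
          deviates d \<gamma> (l \<sigma>) (P \<sigma>) (g \<sigma>) (h \<sigma>) (real t * \<epsilon>)}))"
      unfolding bchoice_iff by (elim exE) (rule that)
    note hPl = this[rule_format, OF CollectI]
    define lo' where "lo' = Min (l ` Pow {..<L})"
    have lo': "0 < lo'" unfolding lo'_def using hPl by (subst Min_gr_iff) auto
    have lo'_le: "lo' \<le> l \<sigma>" if "\<sigma> \<subseteq> {..<L}" for \<sigma>
      unfolding lo'_def using that by (intro Min_le) auto
    define g' where "g' \<sigma> = (if L \<in> \<sigma> then h (\<sigma> - {L}) else g \<sigma>)" for \<sigma>
    define Q' where "Q' = Q(L := P)"
    define lon where "lon = lo(L := lo')"
    define mn where "mn = mesh(L := \<mu>)"
    have g'_old: "g' \<sigma> = g \<sigma>" if "\<sigma> \<subseteq> {..<L}" for \<sigma> using that by (auto simp: g'_def)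
    have g'_new: "g' (insert L \<sigma>) = h \<sigma>" if "\<sigma> \<subseteq> {..<L}" for \<sigma>
    proof -
      have "insert L \<sigma> - {L} = \<sigma>" using that by auto
      then show ?thesis by (simp add: g'_def)
    qed
    have g'T: "g' \<sigma> \<in> T" if "\<sigma> \<subseteq> {..<Suc L}" for \<sigma>
    proof -
      have "\<sigma> - {L} \<subseteq> {..<L}" using that by (auto simp: less_Suc_eq)
      moreover have "\<sigma> - {L} = \<sigma>" if "L \<notin> \<sigma>" using that by auto
      ultimately show ?thesis using hPl gT by (auto simp: g'_def)
    qed
    have sub: "insert n \<sigma> \<subseteq> {..<L}" "\<sigma> \<subseteq> {..<L}" if "n < L" "\<sigma> \<subseteq> {..<n}" for n \<sigma>
      using that by auto
    have "geodesic_tree M d u v \<gamma> c (Suc L) g' Q' lon mn"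
    proof (unfold_locales, goal_cases)
      case 1 show ?case by (rule D)
    next
      case 2 show ?case by (rule pos)
    next
      case 3 then show ?case using g'T T by auto
    next
      case (4 n \<sigma>) then show ?case using Q_subset[of n \<sigma>] hPl[of \<sigma>] by (cases "n = L") (auto simp: Q'_def)
    next
      case (5 n \<sigma>) then show ?case using Q_0[of n \<sigma>] hPl[of \<sigma>] by (cases "n = L") (auto simp: Q'_def)
    next
      case (6 n \<sigma> x)
      show ?case
      proof (cases "n = L")
        case True then show ?thesis using 6 hPl[of \<sigma>] g'_old[of \<sigma>] g'_new[of \<sigma>] by (simp add: Q'_def)
      next
        case False
        then have "n < L" using 6 by simp
        then show ?thesis using 6 g_agree[of n \<sigma> x] sub[of n \<sigma>] g'_old False by (simp add: Q'_def)
      qed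
    next
      case (7 n \<sigma>)
      show ?case
      proof (cases "Suc n = L")
        case True
        then have "R \<sigma> = G \<union> Q n (\<sigma> \<inter> {..<n})" by (auto simp: R_def)
        then show ?thesis using 7 hPl[of \<sigma>] True by (auto simp: Q'_def)
      next
        case False
        then show ?thesis using 7 Q_Suc[of n \<sigma>] by (simp add: Q'_def)
      qed
    next
      case (8 n \<sigma> x)
      show ?case
      proof (cases "n = L")
        case True
        then have "G \<subseteq> P \<sigma>" using hPl[of \<sigma>] 8 by (auto simp: R_def)
        then show ?thesis using True G(3)[of x] 8 by (auto simp: Q'_def mn_def)
      next
        case False
        then show ?thesis using 8 Q_mesh[of n \<sigma> x] by (auto simp: Q'_def mn_def)
      qed
    next
      case (9 n) then show ?case using lo_pos[of n] lo' by (auto simp: lon_def)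
    next
      case (10 m n)
      show ?case
      proof (cases "n = L")
        case True
        then have "m < L" using 10 by simp
        then have "\<mu> \<le> min 1 \<gamma> * lo m / 8" "0 < lo m" using \<mu>_lo lo_pos by auto
        moreover have "min 1 \<gamma> * lo m \<le> 1 * lo m" using \<open>0 < lo m\<close> by (intro mult_right_mono) auto
        ultimately have "8 * \<mu> \<le> lo m" by (simp only: mult_1)
        then have "4 * \<mu> < lo m" using \<mu> by linarith
        then show ?thesis using True \<open>m < L\<close> by (simp add: lon_def mn_def)
      next
        case False
        then show ?thesis using 10 mesh_lo[of m n] by (simp add: lon_def mn_def)
      qed
    next
      case (11 m n)
      show ?case
      proof (cases "n = L")
        case True
        then have "m < L" using 11 by simp
        then have "\<mu> \<le> min 1 \<gamma> * lo m / 8" "0 < lo m" using \<mu>_lo lo_pos by auto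
        moreover have "min 1 \<gamma> * lo m \<le> \<gamma> * lo m" using \<open>0 < lo m\<close> by (intro mult_right_mono) auto
        ultimately have "8 * \<mu> \<le> \<gamma> * lo m" by linarith
        then show ?thesis using True \<open>m < L\<close> by (simp add: lon_def mn_def)
      next
        case False
        then show ?thesis using 11 mesh_lo_\<gamma>[of m n] by (simp add: lon_def mn_def)
      qed
    next
      case (12 n \<sigma> \<epsilon>)
      show ?case
      proof (cases "n = L")
        case True
        then have \<sigma>: "\<sigma> \<subseteq> {..<L}" and \<epsilon>: "\<epsilon> \<le> lo'" using 12 by (auto simp: lon_def)
        have "c / \<epsilon> \<le> real (card {t::nat. real t * \<epsilon> < d u v \<and>
          deviates d \<gamma> (l \<sigma>) (P \<sigma>) (g \<sigma>) (h \<sigma>) (real t * \<epsilon>)})"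
          using hPl[OF \<sigma>] 12 \<epsilon> lo'_le[OF \<sigma>] by (meson order_trans)
        \<comment> \<open>Passing from the threshold of the node to the common one enlarges the set
          of good times; finiteness is checked because an infinite set has \<open>card\<close>
          0.\<close>
        also have "\<dots> \<le> real (card {t::nat. real t * \<epsilon> < d u v \<and>
          deviates d \<gamma> lo' (P \<sigma>) (g \<sigma>) (h \<sigma>) (real t * \<epsilon>)})"
        proof (intro of_nat_mono card_mono)
          show "finite {t::nat. real t * \<epsilon> < d u v \<and> deviates d \<gamma> lo' (P \<sigma>) (g \<sigma>) (h \<sigma>) (real t * \<epsilon>)}"
          proof (rule finite_subset)
            show "finite {..nat \<lceil>d u v / \<epsilon>\<rceil>}" by simp
            show "{t::nat. real t * \<epsilon> < d u v \<and> deviates d \<gamma> lo' (P \<sigma>) (g \<sigma>) (h \<sigma>) (real t * \<epsilon>)}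
              \<subseteq> {..nat \<lceil>d u v / \<epsilon>\<rceil>}"
            proof clarify
              fix t :: nat assume "real t * \<epsilon> < d u v"
              then have "real t < d u v / \<epsilon>" using 12 by (simp add: pos_less_divide_eq)
              also have "\<dots> \<le> real (nat \<lceil>d u v / \<epsilon>\<rceil>)" by (rule real_nat_ceiling_ge)
              finally show "t \<le> nat \<lceil>d u v / \<epsilon>\<rceil>" by simp
            qed
          qed
        qed (use deviates_mono lo'_le[OF \<sigma>] in blast)
        finally show ?thesis using True g'_old[OF \<sigma>] g'_new[OF \<sigma>] by (simp add: Q'_def lon_def)
      next
        case False
        then have "n < L" using 12 by simp
        then show ?thesis using 12 card_deviates[of n \<sigma> \<epsilon>] False sub[of n \<sigma>] g'_old by (simp add: Q'_def lon_def)
      qed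
    qed
    moreover have "finite (Q' n \<sigma>)" if "n < Suc L" "\<sigma> \<subseteq> {..<n}" for n \<sigma>
      using that hPl[of \<sigma>] Qfin[of n \<sigma>] by (cases "n = L") (auto simp: Q'_def)
    ultimately show ?case using g'T
      by (intro exI[of _ g'] exI[of _ Q'] exI[of _ lon] exI[of _ mn] conjI allI impI)
  qed
  note * = this
  show ?thesis
  proof (rule that[OF pos])
    show "\<exists>g Q lo mesh. geodesic_tree M d u v \<gamma> c L g Q lo mesh" for L
      using *[of L] by (elim exE conjE) (intro exI)
  qed
qed

end

section \<open>Markov chains driven by independent noise\<close>

text \<open>The hypothesis on \<open>h\<close> says that it does not read coordinate
  \<open>i\<close>. After coordinate \<open>i\<close> is split off the product, \<open>h\<close>
  depends on the remaining factor alone.\<close>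

lemma pmf_Pi_pmf_indep_component:
  assumes A: "finite A" "i \<in> A" and h: "\<And>w y. h (w(i := y)) = h w"
  shows "map_pmf (\<lambda>w. (h w, w i)) (Pi_pmf A dflt p) = pair_pmf (map_pmf h (Pi_pmf A dflt p)) (p i)"
proof -
  let ?P = "Pi_pmf (A - {i}) dflt p"
  have Pi: "Pi_pmf A dflt p = map_pmf (\<lambda>(y, f). f(i := y)) (pair_pmf (p i) ?P)"
    using Pi_pmf_insert[of "A - {i}" i dflt p] A by (simp add: insert_absorb)
  have "map_pmf h (Pi_pmf A dflt p) = map_pmf h (map_pmf snd (pair_pmf (p i) ?P))"
    unfolding Pi map_pmf_comp by (intro map_pmf_cong refl) (auto simp: h)
  then have h': "map_pmf h (Pi_pmf A dflt p) = map_pmf h ?P" by (simp add: map_snd_pair_pmf)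
  have "map_pmf (\<lambda>w. (h w, w i)) (Pi_pmf A dflt p) = map_pmf (\<lambda>(y, f). (h f, y)) (pair_pmf (p i) ?P)"
    unfolding Pi map_pmf_comp by (intro map_pmf_cong refl) (auto simp: h)
  also have "\<dots> = map_pmf (\<lambda>(f, y). (h f, y)) (pair_pmf ?P (p i))"
    by (subst pair_commute_pmf) (simp add: map_pmf_comp case_prod_unfold)
  also have "\<dots> = pair_pmf (map_pmf h ?P) (p i)"
    using map_pair[of h id ?P "p i"] by (simp add: pmf.map_id map_prod_def)
  finally show ?thesis by (simp add: h')
qed

lemma prob_Pi_pmf_indep_component:
  assumes A: "finite A" "i \<in> A" and H: "\<And>w y. H (w(i := y)) = H w"
  shows "measure_pmf.prob (Pi_pmf A dflt p) {w. H w \<and> k (w i) = z} =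
    measure_pmf.prob (Pi_pmf A dflt p) {w. H w} * pmf (map_pmf k (p i)) z"
proof -
  let ?P = "Pi_pmf A dflt p"
  have "map_pmf (\<lambda>w. (H w, k (w i))) ?P = map_pmf (map_prod id k) (map_pmf (\<lambda>w. (H w, w i)) ?P)"
    by (simp add: map_pmf_comp)
  also have "\<dots> = pair_pmf (map_pmf H ?P) (map_pmf k (p i))"
    unfolding pmf_Pi_pmf_indep_component[of A i H, OF A H]
    by (simp add: map_prod_def map_pair pmf.map_id)
  finally have "pmf (map_pmf (\<lambda>w. (H w, k (w i))) ?P) (True, z) = pmf (map_pmf H ?P) True * pmf (map_pmf k (p i)) z"
    by (simp add: pmf_pair)
  then show ?thesis by (simp add: pmf_map vimage_def)
qed

text \<open>The second component of a noise index is False for the steps shared with the undisturbed walk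
  and True for the fresh steps taken after time \<open>c\<close>.\<close>

fun walk :: "(nat \<Rightarrow> 's \<Rightarrow> 'u \<Rightarrow> 's) \<Rightarrow> 's \<Rightarrow> nat \<Rightarrow> nat \<Rightarrow> (nat \<times> bool \<Rightarrow> 'u) \<Rightarrow> 's" where
  "walk F x0 c 0 w = x0"
| "walk F x0 c (Suc t) w = F t (walk F x0 c t w) (w (t, c \<le> t))"

lemma walk_eq: "t \<le> c \<Longrightarrow> t \<le> c' \<Longrightarrow> walk F x0 c t w = walk F x0 c' t w"
  by (induction t) auto

lemma walk_fun_upd: "(\<And>r. r < t \<Longrightarrow> i \<noteq> (r, c \<le> r)) \<Longrightarrow> walk F x0 c t (w(i := y)) = walk F x0 c t w"
  by (induction t) auto

text \<open>One noise space carries the chain and all its branched processes: branching at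
  \<open>k\<close> means reading fresh coordinates from \<open>k\<close> on. The chain itself is the
  walk with c = N, as no step before \<open>N\<close> is then fresh. Clamping the time freezes the
  walk outside 0..N, where \<open>K\<close> is the identity kernel.\<close>

lemma markov_convex_walk:
  fixes F :: "nat \<Rightarrow> nat \<Rightarrow> 'u \<Rightarrow> nat" and x0 N :: nat and dflt :: 'u and \<mu> :: "'u pmf"
  assumes conv: "markov_convex_with C p M d" and f: "range f \<subseteq> M"
  defines "\<Omega> \<equiv> Pi_pmf ({..<N} \<times> UNIV) dflt (\<lambda>_. \<mu>)"
  defines "X \<equiv> \<lambda>c t. walk F x0 c (min (nat t) N)"
  shows "(\<Sum>k. \<Sum>\<^sub>\<infinity>t. (\<integral>\<^sup>+w. ennreal (d (f (X N t w)) (f (X (nat (t - 2 ^ k)) t w)) powr p) \<partial>\<Omega>)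
                     / ennreal (2 powr (real k * p)))
        \<le> ennreal (C powr p) *
          (\<Sum>\<^sub>\<infinity>t. \<integral>\<^sup>+w. ennreal (d (f (X N t w)) (f (X N (t - 1) w)) powr p) \<partial>\<Omega>)"
proof -
  \<comment> \<open>The support of a \<open>pmf\<close> is countable, so \<open>enc\<close> is
    injective on it and transports the noise to the sample type \<open>real\<close>.\<close>
  define enc :: "(nat \<times> bool \<Rightarrow> 'u) \<Rightarrow> real" where "enc = (\<lambda>w. real (to_nat_on (set_pmf \<Omega>) w))"
  define dec where "dec x = from_nat_into (set_pmf \<Omega>) (nat \<lfloor>x::real\<rfloor>)" for x
  define Pp where "Pp = map_pmf enc \<Omega>"
  define P where "P = measure_pmf Pp"
  have dec: "map_pmf dec Pp = \<Omega>"
  proof -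
    have "map_pmf dec Pp = map_pmf (\<lambda>w. w) \<Omega>"
      unfolding Pp_def map_pmf_comp by (intro map_pmf_cong refl) (simp add: dec_def enc_def)
    then show ?thesis by (simp add: pmf.map_ident)
  qed
  have prob: "measure P {\<omega> \<in> space P. H (dec \<omega>)} = measure \<Omega> {w. H w}" for H
    unfolding dec[symmetric] P_def by (simp add: vimage_def)
  have integral: "(\<integral>\<^sup>+\<omega>. G (dec \<omega>) \<partial>P) = (\<integral>\<^sup>+w. G w \<partial>\<Omega>)" for G
    unfolding dec[symmetric] P_def by simp
  define K where "K b s = (if 0 \<le> b \<and> b < int N then map_pmf (F (nat b) s) \<mu> else return_pmf s)" for b s
  \<comment> \<open>The next state is a function of the current one and of a single noise
    coordinate. Any event that ignores this coordinate and determines the current state may be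
    conditioned on, which covers both definitions to be verified.\<close>
  have step: "measure \<Omega> {w. H w \<and> X c (b + 1) w = y'} = measure \<Omega> {w. H w} * pmf (K b y) y'"
    if H: "\<And>w z. 0 \<le> b \<Longrightarrow> b < int N \<Longrightarrow> H (w((nat b, c \<le> nat b) := z)) = H w"
      and y: "\<And>w. H w \<Longrightarrow> X c b w = y" for H b c y y'
  proof (cases "0 \<le> b \<and> b < int N")
    case True
    then have min: "min (nat (b + 1)) N = Suc (nat b)" "min (nat b) N = nat b" by auto
    have "{w. H w \<and> X c (b + 1) w = y'} = {w. H w \<and> F (nat b) y (w (nat b, c \<le> nat b)) = y'}"
      using y unfolding X_def min by auto
    also have "measure \<Omega> \<dots> = measure \<Omega> {w. H w} * pmf (map_pmf (F (nat b) y) \<mu>) y'"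
      unfolding \<Omega>_def using True H by (intro prob_Pi_pmf_indep_component) auto
    finally show ?thesis using True by (simp add: K_def)
  next
    case False
    then have "min (nat (b + 1)) N = min (nat b) N" by auto
    then have "{w. H w \<and> X c (b + 1) w = y'} = (if y = y' then {w. H w} else {})"
      using y unfolding X_def by auto
    then show ?thesis using False by (auto simp: K_def)
  qed
  have split: "(\<forall>r\<in>{a..b + 1}. R r) \<longleftrightarrow> (\<forall>r\<in>{a..b}. R r) \<and> R (b + 1)" if "a \<le> b" for a b :: int and R
  proof -
    have "{a..b + 1} = insert (b + 1) {a..b}" using that by auto
    then show ?thesis by auto
  qed
  have past: "X c r (w((nat b, e) := z)) = X c r w" if "r \<le> b" for c r w b e z
    unfolding X_def using that by (intro walk_fun_upd) auto
  \<comment> \<open>The undisturbed walk reads only coordinates flagged False, so even its future is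
    independent of a fresh step.\<close>
  have other: "X N r (w((t, True) := z)) = X N r w" for r w t z
    unfolding X_def by (intro walk_fun_upd) auto
  have meas: "Z \<in> measurable P (count_space UNIV)" for Z :: "real \<Rightarrow> nat"
    by (simp add: P_def)
  have "markov_chain P K (\<lambda>t \<omega>. X N t (dec \<omega>))"
    unfolding markov_chain_def
  proof (intro conjI allI impI meas)
    show "prob_space P" unfolding P_def by (rule prob_space_measure_pmf)
    fix a b :: int and x :: "int \<Rightarrow> nat" assume ab: "a \<le> b"
    have "measure \<Omega> {w. (\<forall>r\<in>{a..b}. X N r w = x r) \<and> X N (b + 1) w = x (b + 1)} =
        measure \<Omega> {w. \<forall>r\<in>{a..b}. X N r w = x r} * pmf (K b (x b)) (x (b + 1))"
      using ab by (intro step) (auto simp: past)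
    then show "measure P {\<omega> \<in> space P. \<forall>r\<in>{a..b + 1}. X N r (dec \<omega>) = x r} =
        measure P {\<omega> \<in> space P. \<forall>r\<in>{a..b}. X N r (dec \<omega>) = x r} * pmf (K b (x b)) (x (b + 1))"
      unfolding prob[of "\<lambda>w. \<forall>r\<in>{a..b + 1}. X N r w = x r"] prob[of "\<lambda>w. \<forall>r\<in>{a..b}. X N r w = x r"]
      unfolding split[OF ab] .
  qed
  moreover have "branched_process P K (\<lambda>t \<omega>. X N t (dec \<omega>)) k (\<lambda>t \<omega>. X (nat k) t (dec \<omega>))" for k
    unfolding branched_process_def
  proof (intro conjI allI impI meas ballI)
    show "X (nat k) t (dec \<omega>) = X N t (dec \<omega>)" if "t \<le> k" for t \<omega>
      unfolding X_def using that by (intro walk_eq) auto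
    fix a b c and x y :: "int \<Rightarrow> nat" assume abk: "a \<le> k \<and> k \<le> b"
    then have ab: "a \<le> b" by simp
    \<comment> \<open>The next step of the branched walk is therefore fresh. Negative
      \<open>k\<close> amounts to branching at 0, since nothing moves before time 0.\<close>
    have flag: "nat k \<le> nat b" using abk by (simp add: nat_mono)
    have "measure \<Omega> {w. ((\<forall>r\<in>{a..c}. X N r w = x r) \<and> (\<forall>r\<in>{a..b}. X (nat k) r w = y r)) \<and> X (nat k) (b + 1) w = y (b + 1)} =
        measure \<Omega> {w. (\<forall>r\<in>{a..c}. X N r w = x r) \<and> (\<forall>r\<in>{a..b}. X (nat k) r w = y r)} * pmf (K b (y b)) (y (b + 1))"
      using ab flag by (intro step) (auto simp: past other)
    then show "measure P {\<omega> \<in> space P. (\<forall>r\<in>{a..c}. X N r (dec \<omega>) = x r) \<and> (\<forall>r\<in>{a..b + 1}. X (nat k) r (dec \<omega>) = y r)} =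
        measure P {\<omega> \<in> space P. (\<forall>r\<in>{a..c}. X N r (dec \<omega>) = x r) \<and> (\<forall>r\<in>{a..b}. X (nat k) r (dec \<omega>) = y r)}
          * pmf (K b (y b)) (y (b + 1))"
      unfolding prob[of "\<lambda>w. (\<forall>r\<in>{a..c}. X N r w = x r) \<and> (\<forall>r\<in>{a..b + 1}. X (nat k) r w = y r)"]
        prob[of "\<lambda>w. (\<forall>r\<in>{a..c}. X N r w = x r) \<and> (\<forall>r\<in>{a..b}. X (nat k) r w = y r)"]
      unfolding split[OF ab] by (simp only: conj_assoc)
  qed
  ultimately have "(\<Sum>k. \<Sum>\<^sub>\<infinity>t. (\<integral>\<^sup>+\<omega>. ennreal (d (f (X N t (dec \<omega>))) (f (X (nat (t - 2 ^ k)) t (dec \<omega>))) powr p) \<partial>P)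
                     / ennreal (2 powr (real k * p)))
        \<le> ennreal (C powr p) *
          (\<Sum>\<^sub>\<infinity>t. \<integral>\<^sup>+\<omega>. ennreal (d (f (X N t (dec \<omega>))) (f (X N (t - 1) (dec \<omega>))) powr p) \<partial>P)"
    using conv[unfolded markov_convex_with_def, rule_format,
        of P K "\<lambda>t \<omega>. X N t (dec \<omega>)" "\<lambda>k t \<omega>. X (nat k) t (dec \<omega>)" f] f by simp
  then show ?thesis
    by (simp only: integral[of "\<lambda>w. ennreal (d (f (X N _ w)) (f (X _ _ w)) powr p)"])
qed

section \<open>The random walk on a tree of geodesics\<close>

lemma pair_pmf_of_set:
  assumes "finite A" "A \<noteq> {}" "finite B" "B \<noteq> {}"
  shows "pair_pmf (pmf_of_set A) (pmf_of_set B) = pmf_of_set (A \<times> B)"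
proof (rule pmf_eqI)
  fix x show "pmf (pair_pmf (pmf_of_set A) (pmf_of_set B)) x = pmf (pmf_of_set (A \<times> B)) x"
    by (cases x) (simp add: pmf_pair indicator_def card_cartesian_product assms)
qed

lemma map_pmf_Pi_pmf_fun_upd:
  assumes A: "finite A" "i \<in> A" and f: "map_pmf f (p i) = p i"
  shows "map_pmf (\<lambda>w. w(i := f (w i))) (Pi_pmf A dflt p) = Pi_pmf A dflt p"
proof -
  let ?P = "Pi_pmf (A - {i}) dflt p"
  have Pi: "Pi_pmf A dflt p = map_pmf (\<lambda>(y, w). w(i := y)) (pair_pmf (p i) ?P)"
    using Pi_pmf_insert[of "A - {i}" i dflt p] A by (simp add: insert_absorb)
  have "map_pmf (\<lambda>w. w(i := f (w i))) (Pi_pmf A dflt p) =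
      map_pmf (\<lambda>(y, w). w(i := y)) (map_pmf (\<lambda>(y, w). (f y, w)) (pair_pmf (p i) ?P))"
    unfolding Pi map_pmf_comp by (intro map_pmf_cong refl) auto
  also have "map_pmf (\<lambda>(y, w). (f y, w)) (pair_pmf (p i) ?P) = pair_pmf (p i) ?P"
    using map_pair[of f id "p i" ?P] f by (simp add: pmf.map_id map_prod_def)
  finally show ?thesis by (simp only: Pi)
qed

lemma power2_between:
  fixes m :: nat
  assumes "0 < m"
  obtains k where "m \<le> 2 ^ k" "2 ^ k < 2 * m"
proof
  define k where "k = (LEAST k. m \<le> 2 ^ k)"
  show "m \<le> 2 ^ k" unfolding k_def by (rule LeastI[of _ m]) (simp add: less_imp_le)
  show "2 ^ k < 2 * m"
  proof (cases k)
    case (Suc j)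
    then have "\<not> m \<le> 2 ^ j" using not_less_Least[of j "\<lambda>k. m \<le> 2 ^ k"] by (simp add: k_def)
    then show ?thesis using Suc by simp
  qed (use assms in simp)
qed

lemma ennreal_half_le:
  fixes I :: ennreal
  assumes "ennreal a \<le> I + I"
  shows "ennreal (a / 2) \<le> I"
proof (cases I)
  case (real r)
  then show ?thesis using assms by (simp flip: ennreal_plus)
qed simp

text \<open>A time step no longer than any \<open>lo n\<close> resolves every depth: rounding a
  branch point down to the grid at most doubles the elapsed time of a counted deviation.\<close>

locale tree_walk = geodesic_tree M d u v \<gamma> c L g Q lo mesh
  for M :: "'a set" and d u v \<gamma> c L g Q lo mesh +
  fixes N :: nat
  assumes N_pos: "0 < N" and N_large: "n < L \<Longrightarrow> d u v / real N \<le> lo n"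
begin

definition \<epsilon> :: real where "\<epsilon> = d u v / real N"

text \<open>Half-open steps make the walk pass each branch point in exactly one step.\<close>

definition keep :: "nat \<Rightarrow> nat set \<Rightarrow> nat \<Rightarrow> bool" where
  "keep t \<sigma> j \<longleftrightarrow> Q j (\<sigma> \<inter> {..<j}) \<inter> {real t * \<epsilon>..<real (Suc t) * \<epsilon>} = {}"

definition step :: "nat \<Rightarrow> nat set \<Rightarrow> nat set \<Rightarrow> nat set" where
  "step t \<sigma> w = {j. j < L \<and> (if keep t \<sigma> j then j \<in> \<sigma> else j \<in> w)}"

abbreviation U :: "nat set pmf" where "U \<equiv> pmf_of_set (Pow {..<L})"

abbreviation S :: "nat \<Rightarrow> nat \<Rightarrow> (nat \<times> bool \<Rightarrow> nat set) \<Rightarrow> nat set" where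
  "S \<equiv> walk step {}"

abbreviation \<Omega> :: "(nat \<times> bool \<Rightarrow> nat set) pmf" where
  "\<Omega> \<equiv> Pi_pmf ({..<N} \<times> UNIV) {} (\<lambda>_. U)"

lemma \<epsilon>_pos: "0 < \<epsilon>" using D_pos N_pos by (simp add: \<epsilon>_def)

lemma \<epsilon>_le_lo: "n < L \<Longrightarrow> \<epsilon> \<le> lo n" using N_large by (simp add: \<epsilon>_def)

section \<open>Uniform distribution of the words\<close>

lemma Q_mono: "i \<le> j \<Longrightarrow> j < L \<Longrightarrow> Q i (\<sigma> \<inter> {..<i}) \<subseteq> Q j (\<sigma> \<inter> {..<j})"
proof (induction j rule: dec_induct)
  case (step n)
  have "\<sigma> \<inter> {..<Suc n} \<inter> {..<n} = \<sigma> \<inter> {..<n}" by auto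
  then have "Q n (\<sigma> \<inter> {..<n}) \<subseteq> Q (Suc n) (\<sigma> \<inter> {..<Suc n})"
    using Q_Suc[of n "\<sigma> \<inter> {..<Suc n}"] step.prems by simp
  then show ?case using step by auto
qed simp

text \<open>Agreement sets grow along a branch, so the kept digits form an initial segment and the
  resampled ones are all those from some depth on.\<close>

lemma keep_antimono: "keep t \<sigma> j \<Longrightarrow> i \<le> j \<Longrightarrow> j < L \<Longrightarrow> keep t \<sigma> i"
  using Q_mono[of i j \<sigma>] unfolding keep_def by blast

lemma keep_cong: "\<sigma> \<inter> {..<j} = \<sigma>' \<inter> {..<j} \<Longrightarrow> keep t \<sigma> j = keep t \<sigma>' j"
  by (simp add: keep_def)

lemma step_prefix: "(\<And>i. i < j \<Longrightarrow> keep t \<sigma> i) \<Longrightarrow> j \<le> L \<Longrightarrow> step t \<sigma> w \<inter> {..<j} = \<sigma> \<inter> {..<j}"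
  by (auto simp: step_def)

text \<open>Whether digit \<open>j\<close> is kept depends only on the digits below it, and these change only if one of
  them is itself resampled.\<close>

lemma keep_step:
  assumes j: "j < L"
  shows "keep t (step t \<sigma> w) j = keep t \<sigma> j"
proof (cases "keep t \<sigma> j")
  case True
  then have "step t \<sigma> w \<inter> {..<j} = \<sigma> \<inter> {..<j}"
    using keep_antimono[of t \<sigma> j] j by (intro step_prefix) auto
  then show ?thesis by (rule keep_cong)
next
  case False
  define i where "i = (LEAST i. \<not> keep t \<sigma> i)"
  have i: "\<not> keep t \<sigma> i" unfolding i_def using False by (rule LeastI)
  have ij: "i \<le> j" unfolding i_def using False by (rule Least_le)
  have "step t \<sigma> w \<inter> {..<i} = \<sigma> \<inter> {..<i}"
    using ij j not_less_Least[of _ "\<lambda>i. \<not> keep t \<sigma> i"] unfolding i_def[symmetric]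
    by (intro step_prefix) auto
  then have "\<not> keep t (step t \<sigma> w) i" using i keep_cong by metis
  then show ?thesis using False keep_antimono ij j by metis
qed

lemma S_subset: "S b t w \<subseteq> {..<L}"
  by (cases t) (auto simp: step_def)

text \<open>Exchanging the resampled digits between state and noise is an involution, because by
  \<open>keep_step\<close> the exchange does not alter which digits are kept. It thus preserves the
  uniform law on pairs, and its first component is the new state.\<close>

lemma map_step_uniform: "map_pmf (\<lambda>(\<sigma>, u). step t \<sigma> u) (pair_pmf U U) = U"
proof -
  define \<Phi> where "\<Phi> = (\<lambda>(\<sigma>, u). (step t \<sigma> u, {j. j < L \<and> (if keep t \<sigma> j then j \<in> u else j \<in> \<sigma>)}))"
  have range: "\<Phi> x \<in> Pow {..<L} \<times> Pow {..<L}" for x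
    by (auto simp: \<Phi>_def step_def split: prod.splits)
  have inv: "\<Phi> (\<Phi> x) = x" if "x \<in> Pow {..<L} \<times> Pow {..<L}" for x
  proof -
    obtain \<sigma> u where x: "x = (\<sigma>, u)" "\<sigma> \<subseteq> {..<L}" "u \<subseteq> {..<L}" using \<open>x \<in> _\<close> by auto
    define \<sigma>' where "\<sigma>' = step t \<sigma> u"
    have k: "keep t \<sigma>' j = keep t \<sigma> j" if "j < L" for j using keep_step[OF that] by (simp add: \<sigma>'_def)
    have m: "j \<in> \<sigma>' \<longleftrightarrow> (if keep t \<sigma> j then j \<in> \<sigma> else j \<in> u)" if "j < L" for j
      using that by (simp add: \<sigma>'_def step_def)
    have "step t \<sigma>' {j. j < L \<and> (if keep t \<sigma> j then j \<in> u else j \<in> \<sigma>)} = \<sigma>"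
      using k m x(2) unfolding step_def[of t \<sigma>'] by auto
    moreover have "{j. j < L \<and> (if keep t \<sigma>' j then j \<in> {j. j < L \<and> (if keep t \<sigma> j then j \<in> u else j \<in> \<sigma>)} else j \<in> \<sigma>')} = u"
      using k m x(3) by auto
    ultimately show ?thesis unfolding x(1) \<Phi>_def \<sigma>'_def by (simp only: prod.case)
  qed
  have "bij_betw \<Phi> (Pow {..<L} \<times> Pow {..<L}) (Pow {..<L} \<times> Pow {..<L})"
    by (rule bij_betwI[of _ _ _ \<Phi>]) (use range inv in auto)
  then have bij: "map_pmf \<Phi> (pair_pmf U U) = pair_pmf U U"
    by (simp add: pair_pmf_of_set Pow_not_empty map_pmf_of_set_bij_betw)
  have "map_pmf (\<lambda>(\<sigma>, u). step t \<sigma> u) (pair_pmf U U) = map_pmf fst (map_pmf \<Phi> (pair_pmf U U))"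
    unfolding map_pmf_comp by (intro map_pmf_cong refl) (auto simp: \<Phi>_def)
  also have "\<dots> = U" unfolding bij by (rule map_fst_pair_pmf)
  finally show ?thesis .
qed

text \<open>Every agreement set contains 0, so the first step forgets the initial word and the law
  is uniform from time 1 on.\<close>

lemma not_keep_0: "j < L \<Longrightarrow> \<not> keep 0 \<sigma> j"
  using Q_0[of j "\<sigma> \<inter> {..<j}"] \<epsilon>_pos unfolding keep_def by auto

lemma S_uniform: "0 < t \<Longrightarrow> t \<le> N \<Longrightarrow> map_pmf (S b t) \<Omega> = U"
proof (induction t)
  case (Suc t)
  let ?i = "(t, b \<le> t)"
  have i: "?i \<in> {..<N} \<times> UNIV" "finite ({..<N} \<times> (UNIV :: bool set))" using Suc.prems by auto
  show ?case
  proof (cases "t = 0")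
    case True
    have "map_pmf (S b (Suc t)) \<Omega> = map_pmf (step 0 {}) (map_pmf (\<lambda>w. w ?i) \<Omega>)"
      unfolding True map_pmf_comp by (intro map_pmf_cong refl) simp
    also have "map_pmf (\<lambda>w. w ?i) \<Omega> = U" using i by (subst Pi_pmf_component) auto
    also have "map_pmf (step 0 {}) U = map_pmf (\<lambda>w. w) U"
      by (intro map_pmf_cong refl) (auto simp: step_def not_keep_0 Pow_not_empty)
    finally show ?thesis by (simp add: pmf.map_ident)
  next
    case False
    have "map_pmf (S b (Suc t)) \<Omega> = map_pmf (\<lambda>(\<sigma>, u). step t \<sigma> u) (map_pmf (\<lambda>w. (S b t w, w ?i)) \<Omega>)"
      unfolding map_pmf_comp by (intro map_pmf_cong refl) simp
    also have "map_pmf (\<lambda>w. (S b t w, w ?i)) \<Omega> = pair_pmf (map_pmf (S b t) \<Omega>) U"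
      using i by (intro pmf_Pi_pmf_indep_component walk_fun_upd) auto
    also have "\<dots> = pair_pmf U U" using Suc False by simp
    finally show ?thesis by (simp only: map_step_uniform)
  qed
qed simp

lemma prob_prefix:
  assumes t: "0 < t" "t \<le> N" and n: "n < L" and \<tau>: "\<tau> \<subseteq> {..<n}"
  shows "measure_pmf.prob \<Omega> {w. S b t w \<inter> {..<n} = \<tau>} = 1 / 2 ^ n"
proof -
  have "measure_pmf.prob \<Omega> {w. S b t w \<inter> {..<n} = \<tau>} = measure_pmf.prob (map_pmf (S b t) \<Omega>) {\<sigma>. \<sigma> \<inter> {..<n} = \<tau>}"
    by (simp add: vimage_def)
  also have "\<dots> = measure_pmf.prob U {\<sigma>. \<sigma> \<inter> {..<n} = \<tau>}" by (simp only: S_uniform[OF t])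
  also have "\<dots> = real (card (Pow {..<L} \<inter> {\<sigma>. \<sigma> \<inter> {..<n} = \<tau>})) / real (card (Pow {..<L}))"
    by (rule measure_pmf_of_set) auto
  also have "card (Pow {..<L} \<inter> {\<sigma>. \<sigma> \<inter> {..<n} = \<tau>}) = card (Pow {n..<L})"
  proof (rule bij_betw_same_card[symmetric], rule bij_betwI[of "\<lambda>\<rho>. \<tau> \<union> \<rho>" _ _ "\<lambda>\<sigma>. \<sigma> \<inter> {n..}"])
    show "(\<lambda>\<rho>. \<tau> \<union> \<rho>) \<in> Pow {n..<L} \<rightarrow> Pow {..<L} \<inter> {\<sigma>. \<sigma> \<inter> {..<n} = \<tau>}"
    proof
      fix \<rho> assume "\<rho> \<in> Pow {n..<L}"
      then have "\<rho> \<subseteq> {..<L}" "\<rho> \<inter> {..<n} = {}" "\<tau> \<subseteq> {..<L}" using \<tau> n by auto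
      then show "\<tau> \<union> \<rho> \<in> Pow {..<L} \<inter> {\<sigma>. \<sigma> \<inter> {..<n} = \<tau>}" using \<tau> by auto
    qed
    show "(\<tau> \<union> \<rho>) \<inter> {n..} = \<rho>" if "\<rho> \<in> Pow {n..<L}" for \<rho>
    proof -
      have "\<tau> \<inter> {n..} = {}" "\<rho> \<inter> {n..} = \<rho>" using that \<tau> by auto
      then show ?thesis by auto
    qed
    show "\<tau> \<union> \<sigma> \<inter> {n..} = \<sigma>" if "\<sigma> \<in> Pow {..<L} \<inter> {\<sigma>. \<sigma> \<inter> {..<n} = \<tau>}" for \<sigma>
      using that by auto
  qed auto
  also have "real (card (Pow {n..<L})) / real (card (Pow {..<L})) = 1 / 2 ^ n"
  proof -
    have "(2::real) ^ L = 2 ^ n * 2 ^ (L - n)" using n by (simp flip: power_add)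
    then show ?thesis by (simp add: card_Pow)
  qed
  finally show ?thesis .
qed

section \<open>Flipping one coin of the first walker\<close>

definition flip :: "nat \<Rightarrow> nat \<Rightarrow> (nat \<times> bool \<Rightarrow> nat set) \<Rightarrow> nat \<times> bool \<Rightarrow> nat set" where
  "flip n s w = w((s, False) := sym_diff (w (s, False)) {n})"

lemma map_flip:
  assumes "n < L" "s < N"
  shows "map_pmf (flip n s) \<Omega> = \<Omega>"
proof -
  have "bij_betw (\<lambda>u. sym_diff u {n}) (Pow {..<L}) (Pow {..<L})"
    by (rule bij_betwI[of _ _ _ "\<lambda>u. sym_diff u {n}"]) (use assms in auto)
  then have "map_pmf (\<lambda>u. sym_diff u {n}) U = U"
    by (simp add: Pow_not_empty map_pmf_of_set_bij_betw)
  then show ?thesis using map_pmf_Pi_pmf_fun_upd[of "{..<N} \<times> UNIV" "(s, False)" "\<lambda>u. sym_diff u {n}" "\<lambda>_. U" "{}"] assms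
    unfolding flip_def by simp
qed

text \<open>From time \<open>b\<close> on the branched walk reads only coordinates flagged True,
  while the flip touches a coordinate flagged False at step s \<ge> b.\<close>

lemma flip_branch: "b \<le> s \<Longrightarrow> S b t (flip n s w) = S b t w"
  unfolding flip_def by (rule walk_fun_upd) auto

text \<open>Digit \<open>n\<close> is resampled at step \<open>s\<close>, in which the walk passes a point of \<open>Q n \<tau>\<close>, and then
  kept up to time \<open>t\<close>.\<close>

lemma flip_walk:
  assumes n: "n < L" and st: "s < t" "t \<le> N"
    and q: "q \<in> Q n \<tau>" "real s * \<epsilon> \<le> q" "q < real (Suc s) * \<epsilon>"
    and empty: "Q n \<tau> \<inter> {q<..real t * \<epsilon>} = {}"
    and E: "S N t w \<inter> {..<n} = \<tau>"
  shows "S N t (flip n s w) \<inter> {..<n} = \<tau>" "n \<in> S N t (flip n s w) \<longleftrightarrow> n \<notin> S N t w"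
proof -
  \<comment> \<open>The equivalence for arbitrary noise is used twice: backwards from
    \<open>t\<close> for the given noise, then forwards from step \<open>s\<close> for the flipped
    one.\<close>
  have later: "(S N r w \<inter> {..<n} = \<tau> \<longleftrightarrow> S N (Suc s) w \<inter> {..<n} = \<tau>) \<and>
      (S N r w \<inter> {..<n} = \<tau> \<longrightarrow> (n \<in> S N r w \<longleftrightarrow> n \<in> S N (Suc s) w))" if "Suc s \<le> r" "r \<le> t" for r w
    using that
  proof (induction r rule: dec_induct)
    case (step r)
    define \<sigma> where "\<sigma> = S N r w"
    have \<sigma>': "S N (Suc r) w = step r \<sigma> (w (r, N \<le> r))" by (simp add: \<sigma>_def)
    have int: "{real r * \<epsilon>..<real (Suc r) * \<epsilon>} \<subseteq> {q<..real t * \<epsilon>}"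
    proof -
      have "real (Suc s) * \<epsilon> \<le> real r * \<epsilon>" "real (Suc r) * \<epsilon> \<le> real t * \<epsilon>"
        using step.hyps step.prems \<epsilon>_pos by (intro mult_right_mono; simp)+
      then show ?thesis using q by auto
    qed
    have keep: "keep r \<rho> n" if "\<rho> \<inter> {..<n} = \<tau>" for \<rho>
      using int empty that unfolding keep_def by blast
    have pre: "step r \<sigma> (w (r, N \<le> r)) \<inter> {..<Suc n} = \<sigma> \<inter> {..<Suc n}"
      if "step r \<sigma> (w (r, N \<le> r)) \<inter> {..<n} = \<tau> \<or> \<sigma> \<inter> {..<n} = \<tau>"
    proof (rule step_prefix)
      have "keep r \<sigma> n" using that keep keep_step[OF n] by metis
      then show "keep r \<sigma> i" if "i < Suc n" for i using keep_antimono[of r \<sigma> n i] n that by simp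
    qed (use n in simp)
    have sub: "A \<inter> {..<n} = B \<inter> {..<n} \<and> (n \<in> A \<longleftrightarrow> n \<in> B)" if "A \<inter> {..<Suc n} = B \<inter> {..<Suc n}" for A B
    proof -
      have "x \<in> A \<longleftrightarrow> x \<in> B" if "x < Suc n" for x
        using \<open>A \<inter> {..<Suc n} = B \<inter> {..<Suc n}\<close> that by blast
      then show ?thesis by auto
    qed
    show ?case using sub[OF pre] step.IH step.prems unfolding \<sigma>' \<sigma>_def[symmetric] by auto
  qed simp
  \<comment> \<open>The prefix is known after the step; \<open>keep_step\<close> carries the test
    back to the state before it.\<close>
  have at_s: "n \<in> S N (Suc s) w \<longleftrightarrow> n \<in> w (s, False)" if "S N (Suc s) w \<inter> {..<n} = \<tau>" for w
  proof -
    have "\<not> keep s (S N (Suc s) w) n" using q that unfolding keep_def by auto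
    then have "\<not> keep s (S N s w) n" using keep_step[OF n] by simp
    then show ?thesis using n st by (auto simp: step_def)
  qed
  have "S N s (flip n s w) = S N s w" unfolding flip_def by (rule walk_fun_upd) auto
  then have pre: "S N (Suc s) (flip n s w) \<inter> {..<n} = S N (Suc s) w \<inter> {..<n}"
    using st by (auto simp: step_def flip_def)
  have st': "Suc s \<le> t" "t \<le> t" using st by auto
  show 1: "S N t (flip n s w) \<inter> {..<n} = \<tau>" using later[OF st'] pre E by auto
  have "S N (Suc s) w \<inter> {..<n} = \<tau>" "S N (Suc s) (flip n s w) \<inter> {..<n} = \<tau>"
    using later[OF st', of w] E pre by auto
  note a = at_s[OF this(1)] at_s[OF this(2)]
  show "n \<in> S N t (flip n s w) \<longleftrightarrow> n \<notin> S N t w"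
    using later[OF st', of w] later[OF st', of "flip n s w"] E 1 a by (simp add: flip_def)
qed

section \<open>Positions of the walker in the metric space\<close>

lemma time_range: "t \<le> N \<Longrightarrow> real t * \<epsilon> \<in> {0..d u v}"
  using N_pos D_pos by (simp add: \<epsilon>_def field_simps)

lemma time_range': "t < N \<Longrightarrow> real t * \<epsilon> \<in> {0..<d u v}"
  using N_pos D_pos by (simp add: \<epsilon>_def field_simps)

text \<open>Restoring the digits from \<open>m\<close> on one at a time never moves the geodesic at
  \<open>q\<close>, because \<open>q\<close> lies in the agreement set of every deeper node on the
  branch.\<close>

lemma g_prefix_agree:
  assumes \<sigma>: "\<sigma> \<subseteq> {..<L}" and m: "m < L" and q: "q \<in> Q m (\<sigma> \<inter> {..<m})"
  shows "g \<sigma> q = g (\<sigma> \<inter> {..<m}) q"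
proof -
  have "g (\<sigma> \<inter> {..<j}) q = g (\<sigma> \<inter> {..<m}) q" if "m \<le> j" "j \<le> L" for j
    using that
  proof (induction j rule: dec_induct)
    case (step j)
    have "q \<in> Q j (\<sigma> \<inter> {..<j})" using Q_mono[of m j \<sigma>] q step by auto
    then have "g (insert j (\<sigma> \<inter> {..<j})) q = g (\<sigma> \<inter> {..<j}) q"
      using step by (intro g_agree) auto
    moreover have "\<sigma> \<inter> {..<Suc j} = (if j \<in> \<sigma> then insert j (\<sigma> \<inter> {..<j}) else \<sigma> \<inter> {..<j})"
      by (auto simp: less_Suc_eq)
    ultimately show ?case using step by simp
  qed simp
  from this[of L] show ?thesis using m \<sigma> by (simp add: Int_absorb2)
qed

text \<open>At the points of the next agreement set the deeper digits have no effect. Such a point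
  lies at most \<open>mesh (Suc n)\<close> before \<open>x\<close>, and two geodesics part at speed
  at most 2; \<open>mesh_lo_\<gamma>\<close> gives the bound.\<close>

lemma g_prefix_dist:
  assumes \<sigma>: "\<sigma> \<subseteq> {..<L}" and n: "n < L" and x: "x \<in> {0..<d u v}"
  shows "d (g \<sigma> x) (g (\<sigma> \<inter> {..<Suc n}) x) \<le> \<gamma> * lo n / 4"
proof (cases "Suc n < L")
  case True
  obtain q where q: "q \<in> Q (Suc n) (\<sigma> \<inter> {..<Suc n})" "q \<le> x" "x - q \<le> mesh (Suc n)"
    using Q_mesh[OF True _ x, of "\<sigma> \<inter> {..<Suc n}"] by auto
  have "q \<in> {0..d u v}" "x \<in> {0..d u v}" using Q_subset[OF True, of "\<sigma> \<inter> {..<Suc n}"] q x by auto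
  moreover have "\<sigma> \<inter> {..<Suc n} \<subseteq> {..<L}" using \<sigma> by auto
  ultimately have "d (g \<sigma> x) (g (\<sigma> \<inter> {..<Suc n}) x) \<le> 2 * \<bar>x - q\<bar>"
    using geodesic_g \<sigma> g_prefix_agree[OF \<sigma> True q(1)] by (intro geodesics_dist_le) auto
  also have "\<dots> \<le> 2 * mesh (Suc n)" using q by simp
  also have "\<dots> \<le> \<gamma> * lo n / 4" using mesh_lo_\<gamma>[of n "Suc n"] True by simp
  finally show ?thesis .
next
  case False
  then have "\<sigma> \<inter> {..<Suc n} = \<sigma>" using \<sigma> n by (auto simp: Int_absorb2)
  moreover have "g \<sigma> x \<in> M" using geodesic_in[OF geodesic_g[OF \<sigma>]] x by auto
  moreover have "0 \<le> \<gamma> * lo n / 4" using \<gamma>_pos lo_pos[OF n] by simp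
  ultimately show ?thesis by simp
qed

text \<open>If digits are resampled, the agreement set at the lowest such depth has a point
  \<open>q\<close> within this step, and the old and new geodesics coincide there. Switching at
  \<open>q\<close> gives a route of length \<epsilon>.\<close>

lemma walk_step_dist:
  assumes t: "t < N"
  shows "d (g (S b (Suc t) w) (real (Suc t) * \<epsilon>)) (g (S b t w) (real t * \<epsilon>)) \<le> \<epsilon>"
proof -
  define \<sigma> \<sigma>' x x' where "\<sigma> = S b t w" and "\<sigma>' = S b (Suc t) w" and "x = real t * \<epsilon>" and "x' = real (Suc t) * \<epsilon>"
  have sub: "\<sigma> \<subseteq> {..<L}" "\<sigma>' \<subseteq> {..<L}" using S_subset[of b t w] S_subset[of b "Suc t" w] by (simp_all only: \<sigma>_def \<sigma>'_def)
  note geo = geodesic_g[OF sub(1)] geodesic_g[OF sub(2)]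
  have x: "x \<in> {0..d u v}" "x' \<in> {0..d u v}"
    using time_range[OF less_imp_le[OF t]] time_range[OF Suc_leI[OF t]] by (simp_all only: x_def x'_def)
  have xx': "x' = x + \<epsilon>" unfolding x_def x'_def by (simp only: of_nat_Suc distrib_right mult_1 add.commute)
  have \<sigma>': "\<sigma>' = step t \<sigma> (w (t, b \<le> t))" by (simp add: \<sigma>_def \<sigma>'_def)
  have "\<exists>q\<in>{x..x'}. g \<sigma> q = g \<sigma>' q"
  proof (cases "\<forall>j<L. keep t \<sigma> j")
    case True
    then have "\<sigma>' \<inter> {..<L} = \<sigma> \<inter> {..<L}" unfolding \<sigma>' by (intro step_prefix) auto
    then have "\<sigma>' = \<sigma>" using sub by (simp add: Int_absorb2)
    then show ?thesis using xx' \<epsilon>_pos by (intro bexI[of _ x]) auto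
  next
    case False
    define i where "i = (LEAST j. j < L \<and> \<not> keep t \<sigma> j)"
    have i: "i < L \<and> \<not> keep t \<sigma> i" unfolding i_def by (rule LeastI_ex) (use False in auto)
    have "keep t \<sigma> j" if "j < i" for j
      using not_less_Least[of j "\<lambda>j. j < L \<and> \<not> keep t \<sigma> j"] that i unfolding i_def[symmetric] by auto
    then have pre: "\<sigma>' \<inter> {..<i} = \<sigma> \<inter> {..<i}" unfolding \<sigma>' using i by (intro step_prefix) auto
    obtain q where q: "q \<in> Q i (\<sigma> \<inter> {..<i})" "x \<le> q" "q < x'"
      using i unfolding keep_def x_def x'_def by auto
    have "g \<sigma> q = g \<sigma>' q"
      using g_prefix_agree[OF sub(1), of i q] g_prefix_agree[OF sub(2), of i q] i q pre by simp
    then show ?thesis using q by (intro bexI[of _ q]) auto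
  qed
  then obtain q where q: "x \<le> q" "q \<le> x'" "g \<sigma> q = g \<sigma>' q" by auto
  have qD: "q \<in> {0..d u v}" using q x by auto
  have "d (g \<sigma>' x') (g \<sigma> x) \<le> d (g \<sigma>' x') (g \<sigma>' q) + d (g \<sigma> q) (g \<sigma> x)"
    using triangle[of "g \<sigma>' x'" "g \<sigma>' q" "g \<sigma> x"] q(3) geodesic_in[OF geo(1)] geodesic_in[OF geo(2)] x qD by simp
  also have "\<dots> = \<bar>x' - q\<bar> + \<bar>q - x\<bar>"
    using geodesic_dist[OF geo(2) x(2) qD] geodesic_dist[OF geo(1) qD x(1)] by simp
  also have "\<dots> = \<epsilon>" using q xx' by simp
  finally show ?thesis by (simp add: \<sigma>_def \<sigma>'_def x_def x'_def)
qed

text \<open>Truncated after digit \<open>n\<close>, the two words are the two children of \<tau> in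
  some order. Each truncation costs at most \<open>\<gamma> * lo n / 4\<close>.\<close>

lemma flip_separation:
  assumes n: "n < L" and t: "t < N" and sub: "\<sigma> \<subseteq> {..<L}" "\<sigma>' \<subseteq> {..<L}"
    and \<tau>: "\<sigma> \<inter> {..<n} = \<tau>" "\<sigma>' \<inter> {..<n} = \<tau>" and dig: "n \<in> \<sigma>' \<longleftrightarrow> n \<notin> \<sigma>"
  defines "x \<equiv> real t * \<epsilon>"
  shows "d (g \<tau> x) (g (insert n \<tau>) x) - \<gamma> * lo n / 2 \<le> d (g \<sigma> x) (g \<sigma>' x)"
proof -
  have x: "x \<in> {0..<d u v}" unfolding x_def using t by (rule time_range')
  define \<rho> \<rho>' where "\<rho> = \<sigma> \<inter> {..<Suc n}" and "\<rho>' = \<sigma>' \<inter> {..<Suc n}"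
  have "\<rho> = (if n \<in> \<sigma> then insert n \<tau> else \<tau>)" "\<rho>' = (if n \<in> \<sigma>' then insert n \<tau> else \<tau>)"
    unfolding \<rho>_def \<rho>'_def lessThan_Suc using \<tau> by auto
  then have eq: "d (g \<rho> x) (g \<rho>' x) = d (g \<tau> x) (g (insert n \<tau>) x)"
    using dig commute by auto
  have M: "g \<zeta> x \<in> M" if "\<zeta> \<subseteq> {..<L}" for \<zeta>
    using geodesic_in[OF geodesic_g[OF that]] x by auto
  have r: "\<rho> \<subseteq> {..<L}" "\<rho>' \<subseteq> {..<L}" using sub by (auto simp: \<rho>_def \<rho>'_def)
  have "d (g \<rho> x) (g \<rho>' x) \<le> d (g \<rho> x) (g \<sigma> x) + d (g \<sigma> x) (g \<sigma>' x) + d (g \<sigma>' x) (g \<rho>' x)"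
    using triangle[OF M[OF r(1)] M[OF sub(1)] M[OF r(2)]] triangle[OF M[OF sub(1)] M[OF sub(2)] M[OF r(2)]] by linarith
  moreover have "d (g \<rho> x) (g \<sigma> x) \<le> \<gamma> * lo n / 4" "d (g \<sigma>' x) (g \<rho>' x) \<le> \<gamma> * lo n / 4"
    using g_prefix_dist[OF sub(1) n x] g_prefix_dist[OF sub(2) n x] commute[of "g \<sigma> x"] by (simp_all add: \<rho>_def \<rho>'_def)
  ultimately show ?thesis unfolding eq by simp
qed

section \<open>Contribution of one depth at its own time scales\<close>

definition scales :: "nat \<Rightarrow> nat set" where
  "scales n = {k. lo n \<le> 2 ^ k * \<epsilon> \<and> 2 ^ k * \<epsilon> \<le> 4 * mesh n}"

lemma finite_scales: "finite (scales n)"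
proof (rule finite_subset)
  show "scales n \<subseteq> {..nat \<lceil>4 * mesh n / \<epsilon>\<rceil>}"
  proof
    fix k assume "k \<in> scales n"
    then have "2 ^ k \<le> 4 * mesh n / \<epsilon>" using \<epsilon>_pos by (simp only: scales_def pos_le_divide_eq mem_Collect_eq)
    moreover have "real k \<le> 2 ^ k" using less_exp[of k] by (metis less_imp_le of_nat_le_iff of_nat_numeral of_nat_power)
    ultimately have "real k \<le> real (nat \<lceil>4 * mesh n / \<epsilon>\<rceil>)" using real_nat_ceiling_ge order_trans by metis
    then show "k \<in> {..nat \<lceil>4 * mesh n / \<epsilon>\<rceil>}" by simp
  qed
qed simp

text \<open>The elapsed time of a counted deviation at depth \<open>n\<close> lies between
  \<open>lo n\<close> and \<open>mesh n\<close>, and \<open>2 ^ k * \<epsilon>\<close> will be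
  chosen between it and four times it; this explains the bounds in \<open>scales\<close>. The gap in
  \<open>mesh_lo\<close> separates the resulting ranges.\<close>

lemma scales_disjoint: "m < L \<Longrightarrow> n < L \<Longrightarrow> m \<noteq> n \<Longrightarrow> scales m \<inter> scales n = {}"
proof (induction m n rule: linorder_wlog)
  case (le m n)
  then have "4 * mesh n < lo m" by (intro mesh_lo) auto
  then show ?case by (auto simp: scales_def)
next
  case (sym m n)
  then show ?case by auto
qed

text \<open>The prefix is fixed because the set of good times depends on the node \<tau>.\<close>

definition prefix_energy :: "real \<Rightarrow> nat \<Rightarrow> nat set \<Rightarrow> nat \<Rightarrow> nat \<Rightarrow> ennreal" where
  "prefix_energy p n \<tau> k t =
    (\<integral>\<^sup>+w. ennreal (d (g (S N t w) (real t * \<epsilon>)) (g (S (nat (int t - 2 ^ k)) t w) (real t * \<epsilon>)) powr p) *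
      indicator {w. S N t w \<inter> {..<n} = \<tau>} w \<partial>\<Omega>) / ennreal (2 powr (real k * p))"

text \<open>The 16 is a factor 4 lost in the deviation times the factor 4 between
  \<open>2 ^ k * \<epsilon>\<close> and the elapsed time. The power of two is the probability of the
  prefix, and the last half comes from sharing the bound between the walker and its flipped
  version.\<close>

lemma prefix_energy_ge:
  assumes n: "n < L" and \<tau>: "\<tau> \<subseteq> {..<n}" and t: "t < N" and p: "0 < p"
    and dev: "deviates d \<gamma> (lo n) (Q n \<tau>) (g \<tau>) (g (insert n \<tau>)) (real t * \<epsilon>)"
  shows "\<exists>k\<in>scales n. ennreal ((\<gamma> * \<epsilon> / 16) powr p / 2 ^ n / 2) \<le> prefix_energy p n \<tau> k t"
proof -
  define x where "x = real t * \<epsilon>"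
  have x: "x \<in> {0..<d u v}" unfolding x_def using t by (rule time_range')
  obtain q where q: "q \<in> Q n \<tau>" "q < x" "Q n \<tau> \<inter> {q<..x} = {}" "lo n \<le> x - q"
    and dev: "\<gamma> * (x - q) \<le> d (g \<tau> x) (g (insert n \<tau>) x)"
    using dev unfolding deviates_def x_def[symmetric] by auto
  have q0: "0 \<le> q" using Q_subset[OF n \<tau>] q by auto
  have lo0: "0 < lo n" using lo_pos[OF n] .
  \<comment> \<open>The step in which the walk passes \<open>q\<close>, so that digit
    \<open>n\<close> is resampled there.\<close>
  define s where "s = nat \<lfloor>q / \<epsilon>\<rfloor>"
  have "real s \<le> q / \<epsilon>" "q / \<epsilon> < real s + 1"
    using q0 \<epsilon>_pos floor_correct[of "q / \<epsilon>"] unfolding s_def by simp_all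
  then have s: "real s * \<epsilon> \<le> q" "q < real (Suc s) * \<epsilon>"
    using \<epsilon>_pos by (simp_all only: pos_le_divide_eq pos_divide_less_eq of_nat_Suc add.commute[of 1])
  have "real s * \<epsilon> < real t * \<epsilon>" using s q x_def by linarith
  then have st: "s < t" by (simp only: mult_less_cancel_right_pos[OF \<epsilon>_pos] of_nat_less_iff)
  then have "0 < t - s" by simp
  \<comment> \<open>The lower bound on \<open>2 ^ k\<close> makes the second walker branch off no
    later than \<open>s\<close>, before the coin to be flipped is used; the upper bound keeps the
    scale comparable to the elapsed time.\<close>
  then obtain k where k: "t - s \<le> 2 ^ k" "2 ^ k < 2 * (t - s)" by (rule power2_between)
  have kr: "real t - real s \<le> 2 ^ k" "2 ^ k < 2 * (real t - real s)"
  proof -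
    have "real (t - s) \<le> real (2 ^ k)" "real (2 ^ k) < real (2 * (t - s))"
      using k by (simp_all only: of_nat_le_iff of_nat_less_iff)
    then show "real t - real s \<le> 2 ^ k" "2 ^ k < 2 * (real t - real s)"
      using st by (simp_all add: of_nat_diff)
  qed
  have ts: "(real t - real s) * \<epsilon> = x - real s * \<epsilon>" by (simp only: x_def left_diff_distrib)
  have ts': "x - real s * \<epsilon> \<le> (x - q) + \<epsilon>" using s(2) by (simp only: of_nat_Suc distrib_right mult_1)
  have "(real t - real s) * \<epsilon> \<le> 2 ^ k * \<epsilon>" "2 ^ k * \<epsilon> \<le> 2 * (real t - real s) * \<epsilon>"
    using kr \<epsilon>_pos by (intro mult_right_mono; linarith)+
  moreover have "(real t - real s) * \<epsilon> \<le> 2 * (x - q)"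
    unfolding ts using ts' q(4) \<epsilon>_le_lo[OF n] by argo
  ultimately have k1: "x - q \<le> 2 ^ k * \<epsilon>" and k2: "2 ^ k * \<epsilon> \<le> 4 * (x - q)"
    using ts s(1) by (linarith, argo)
  have mesh: "x - q \<le> mesh n"
  proof -
    obtain q' where q': "q' \<in> Q n \<tau>" "q' \<le> x" "x - q' \<le> mesh n" using Q_mesh[OF n \<tau> x] by auto
    then have "q' \<le> q" using q(3) by fastforce
    then show ?thesis using q' by linarith
  qed
  have scale: "k \<in> scales n" using k1 k2 mesh q(4) unfolding scales_def by simp
  define b where "b = nat (int t - 2 ^ k)"
  have bs: "b \<le> s"
  proof -
    have "int t - int s \<le> 2 ^ k"
    proof -
      have "int (t - s) \<le> int (2 ^ k)" using k(1) by (simp only: of_nat_le_iff)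
      then show ?thesis using st by (simp add: of_nat_diff)
    qed
    then show ?thesis unfolding b_def by simp
  qed
  define E where "E = {w. S N t w \<inter> {..<n} = \<tau>}"
  define A where "A w = ennreal (d (g (S N t w) x) (g (S b t w) x) powr p) * indicator E w" for w
  define r where "r = (\<gamma> * (x - q) / 4) powr p"
  have flipE: "flip n s w \<in> E" "n \<in> S N t (flip n s w) \<longleftrightarrow> n \<notin> S N t w" if "w \<in> E" for w
    using flip_walk[OF n st less_imp_le[OF t] q(1) s q(3)[unfolded x_def], of w] that unfolding E_def by auto
  have pw: "ennreal r * indicator E w \<le> A w + A (flip n s w)" for w
  proof (cases "w \<in> E")
    case True
    define \<sigma> \<sigma>' \<rho> where "\<sigma> = S N t w" and "\<sigma>' = S N t (flip n s w)" and "\<rho> = S b t w"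
    have sub: "\<sigma> \<subseteq> {..<L}" "\<sigma>' \<subseteq> {..<L}" "\<rho> \<subseteq> {..<L}" by (simp_all add: \<sigma>_def \<sigma>'_def \<rho>_def S_subset)
    have M: "g \<zeta> x \<in> M" if "\<zeta> \<subseteq> {..<L}" for \<zeta>
      using geodesic_in[OF geodesic_g[OF that]] x by auto
    have "d (g \<tau> x) (g (insert n \<tau>) x) - \<gamma> * lo n / 2 \<le> d (g \<sigma> x) (g \<sigma>' x)"
      unfolding x_def using True flipE[OF True] sub by (intro flip_separation n t) (auto simp: E_def \<sigma>_def \<sigma>'_def)
    moreover have "\<gamma> * lo n \<le> \<gamma> * (x - q)" using q(4) \<gamma>_pos by simp
    moreover have "d (g \<sigma> x) (g \<sigma>' x) \<le> d (g \<sigma> x) (g \<rho> x) + d (g \<sigma>' x) (g \<rho> x)"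
      using triangle[OF M[OF sub(1)] M[OF sub(3)] M[OF sub(2)]] commute[of "g \<rho> x"] by simp
    \<comment> \<open>As \<open>lo n \<le> x - q\<close>, the flipped pair is at distance at least
      \<open>\<gamma> * (x - q) / 2\<close>, so one of its members is at least half as far from the
      second walker.\<close>
    ultimately have "\<gamma> * (x - q) / 4 \<le> d (g \<sigma> x) (g \<rho> x) \<or> \<gamma> * (x - q) / 4 \<le> d (g \<sigma>' x) (g \<rho> x)"
      using dev by argo
    moreover have "0 \<le> \<gamma> * (x - q) / 4" using \<gamma>_pos q by simp
    ultimately have "r \<le> d (g \<sigma> x) (g \<rho> x) powr p \<or> r \<le> d (g \<sigma>' x) (g \<rho> x) powr p"
      unfolding r_def using p by (meson powr_mono2 less_imp_le)
    then have "ennreal r \<le> ennreal (d (g \<sigma> x) (g \<rho> x) powr p) + ennreal (d (g \<sigma>' x) (g \<rho> x) powr p)"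
      by (metis add.commute add_increasing2 ennreal_leI zero_le)
    then show ?thesis using True flipE[OF True] flip_branch[OF bs, of t n w]
      by (simp add: A_def \<sigma>_def \<sigma>'_def \<rho>_def)
  qed simp
  have "ennreal (r / 2 ^ n) = ennreal r * emeasure \<Omega> E"
    using prob_prefix[OF _ _ n \<tau>, of t N] st t unfolding E_def
    by (simp add: measure_pmf.emeasure_eq_measure r_def flip: ennreal_mult)
  also have "\<dots> = (\<integral>\<^sup>+w. ennreal r * indicator E w \<partial>\<Omega>)" by (simp add: nn_integral_cmult_indicator)
  also have "\<dots> \<le> (\<integral>\<^sup>+w. A w + A (flip n s w) \<partial>\<Omega>)" by (intro nn_integral_mono pw)
  also have "\<dots> = (\<integral>\<^sup>+w. A w \<partial>\<Omega>) + (\<integral>\<^sup>+w. A w \<partial>map_pmf (flip n s) \<Omega>)" by (simp add: nn_integral_add)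
  also have "map_pmf (flip n s) \<Omega> = \<Omega>" using n st t by (intro map_flip) auto
  finally have half: "ennreal (r / 2 ^ n / 2) \<le> (\<integral>\<^sup>+w. A w \<partial>\<Omega>)" by (rule ennreal_half_le)
  have y: "2 powr (real k * p) = (2 ^ k) powr p" by (simp add: powr_powr[symmetric] powr_realpow)
  have "(\<gamma> * \<epsilon> / 16) powr p * (2 ^ k) powr p = (\<gamma> * \<epsilon> / 16 * 2 ^ k) powr p"
    by (rule powr_mult[symmetric])
  also have "\<dots> \<le> r" unfolding r_def
  proof (rule powr_mono2)
    have "\<gamma> * (2 ^ k * \<epsilon>) \<le> \<gamma> * (4 * (x - q))" using k2 \<gamma>_pos by (intro mult_left_mono) auto
    then show "\<gamma> * \<epsilon> / 16 * 2 ^ k \<le> \<gamma> * (x - q) / 4" by (simp add: mult_ac)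
  qed (use p \<gamma>_pos \<epsilon>_pos in auto)
  finally have "(\<gamma> * \<epsilon> / 16) powr p \<le> r / (2 ^ k) powr p" by (simp add: pos_le_divide_eq)
  then have "(\<gamma> * \<epsilon> / 16) powr p / 2 ^ n / 2 \<le> r / (2 ^ k) powr p / 2 ^ n / 2"
    by (intro divide_right_mono) auto
  also have "\<dots> = r / 2 ^ n / 2 / 2 powr (real k * p)" by (simp add: y)
  finally have "ennreal ((\<gamma> * \<epsilon> / 16) powr p / 2 ^ n / 2) \<le> ennreal (r / 2 ^ n / 2) / ennreal (2 powr (real k * p))"
    by (simp add: divide_ennreal r_def ennreal_leI)
  also have "\<dots> \<le> prefix_energy p n \<tau> k t"
    unfolding prefix_energy_def x_def[symmetric] b_def[symmetric] E_def[symmetric] A_def[symmetric]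
    by (rule divide_right_mono_ennreal[OF half])
  finally show ?thesis using scale by blast
qed

definition energy :: "real \<Rightarrow> nat \<Rightarrow> nat \<Rightarrow> ennreal" where
  "energy p k t =
    (\<integral>\<^sup>+w. ennreal (d (g (S N t w) (real t * \<epsilon>)) (g (S (nat (int t - 2 ^ k)) t w) (real t * \<epsilon>)) powr p) \<partial>\<Omega>)
      / ennreal (2 powr (real k * p))"

lemma sum_prefix_energy: "(\<Sum>\<tau>\<in>Pow {..<n}. prefix_energy p n \<tau> k t) = energy p k t"
proof -
  define a where "a w = ennreal (d (g (S N t w) (real t * \<epsilon>)) (g (S (nat (int t - 2 ^ k)) t w) (real t * \<epsilon>)) powr p)" for w
  have one: "(\<Sum>\<tau>\<in>Pow {..<n}. indicator {w. S N t w \<inter> {..<n} = \<tau>} w) = (1::ennreal)" for w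
  proof -
    have "(\<Sum>\<tau>\<in>Pow {..<n}. indicator {w. S N t w \<inter> {..<n} = \<tau>} w) =
        (\<Sum>\<tau>\<in>Pow {..<n}. if S N t w \<inter> {..<n} = \<tau> then 1 else (0::ennreal))"
      by (intro sum.cong) (auto simp: indicator_def)
    also have "\<dots> = 1" by (subst sum.delta') auto
    finally show ?thesis .
  qed
  have "(\<Sum>\<tau>\<in>Pow {..<n}. prefix_energy p n \<tau> k t) =
      (\<Sum>\<tau>\<in>Pow {..<n}. \<integral>\<^sup>+w. a w * indicator {w. S N t w \<inter> {..<n} = \<tau>} w \<partial>\<Omega>) / ennreal (2 powr (real k * p))"
    unfolding prefix_energy_def a_def divide_ennreal_def by (rule sum_distrib_right[symmetric])
  also have "(\<Sum>\<tau>\<in>Pow {..<n}. \<integral>\<^sup>+w. a w * indicator {w. S N t w \<inter> {..<n} = \<tau>} w \<partial>\<Omega>) =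
      (\<integral>\<^sup>+w. (\<Sum>\<tau>\<in>Pow {..<n}. a w * indicator {w. S N t w \<inter> {..<n} = \<tau>} w) \<partial>\<Omega>)"
    by (subst nn_integral_sum) auto
  also have "\<dots> = (\<integral>\<^sup>+w. a w \<partial>\<Omega>)" by (simp only: sum_distrib_left[symmetric] one mult_1_right)
  finally show ?thesis by (simp only: energy_def a_def)
qed

text \<open>There are 2 ^ n prefixes, each with at least \<open>c / \<epsilon>\<close> good times of
  weight 2 ^ -n, so the depth cancels from the bound.\<close>

lemma level_energy_ge:
  assumes n: "n < L" and p: "0 < p" and c: "0 < c"
  shows "ennreal (c / \<epsilon> * (\<gamma> * \<epsilon> / 16) powr p / 2) \<le> (\<Sum>k\<in>scales n. \<Sum>t<N. energy p k t)"
proof -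
  define T where "T \<tau> = {t. real t * \<epsilon> < d u v \<and>
    deviates d \<gamma> (lo n) (Q n \<tau>) (g \<tau>) (g (insert n \<tau>)) (real t * \<epsilon>)}" for \<tau>
  define \<beta> where "\<beta> = (\<gamma> * \<epsilon> / 16) powr p / 2 ^ n / 2"
  have T: "T \<tau> \<subseteq> {..<N}" for \<tau>
  proof
    fix t assume "t \<in> T \<tau>"
    then have "real t * d u v < real N * d u v"
      using N_pos by (simp add: T_def \<epsilon>_def pos_divide_less_eq mult.commute)
    then show "t \<in> {..<N}" using D_pos by simp
  qed
  have "ennreal (c / \<epsilon> * (\<gamma> * \<epsilon> / 16) powr p / 2) = (\<Sum>\<tau>\<in>Pow {..<n}. ennreal (c / \<epsilon> * \<beta>))"
    using c \<epsilon>_pos by (simp add: card_Pow \<beta>_def ennreal_of_nat_eq_real_of_nat flip: ennreal_mult)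
  also have "\<dots> \<le> (\<Sum>\<tau>\<in>Pow {..<n}. \<Sum>t\<in>T \<tau>. \<Sum>k\<in>scales n. prefix_energy p n \<tau> k t)"
  proof (rule sum_mono)
    fix \<tau> assume "\<tau> \<in> Pow {..<n}"
    then have \<tau>: "\<tau> \<subseteq> {..<n}" by simp
    have "ennreal (c / \<epsilon> * \<beta>) \<le> ennreal (real (card (T \<tau>)) * \<beta>)"
      unfolding T_def using card_deviates[OF n \<tau> \<epsilon>_pos \<epsilon>_le_lo[OF n]]
      by (intro ennreal_leI mult_right_mono) (auto simp: \<beta>_def)
    also have "\<dots> = (\<Sum>t\<in>T \<tau>. ennreal \<beta>)"
      by (simp add: ennreal_of_nat_eq_real_of_nat \<beta>_def flip: ennreal_mult)
    also have "\<dots> \<le> (\<Sum>t\<in>T \<tau>. \<Sum>k\<in>scales n. prefix_energy p n \<tau> k t)"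
    proof (rule sum_mono)
      fix t assume t: "t \<in> T \<tau>"
      then have "t < N" "deviates d \<gamma> (lo n) (Q n \<tau>) (g \<tau>) (g (insert n \<tau>)) (real t * \<epsilon>)"
        using T by (auto simp: T_def)
      then obtain k where k: "k \<in> scales n" "ennreal \<beta> \<le> prefix_energy p n \<tau> k t"
        using prefix_energy_ge[OF n \<tau> _ p] unfolding \<beta>_def by blast
      have "prefix_energy p n \<tau> k t \<le> (\<Sum>k\<in>scales n. prefix_energy p n \<tau> k t)"
        by (rule member_le_sum[OF k(1)]) (simp_all add: finite_scales)
      then show "ennreal \<beta> \<le> (\<Sum>k\<in>scales n. prefix_energy p n \<tau> k t)" using k(2) by (rule order_trans[rotated])
    qed
    finally show "ennreal (c / \<epsilon> * \<beta>) \<le> (\<Sum>t\<in>T \<tau>. \<Sum>k\<in>scales n. prefix_energy p n \<tau> k t)" .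
  qed
  also have "\<dots> \<le> (\<Sum>\<tau>\<in>Pow {..<n}. \<Sum>t<N. \<Sum>k\<in>scales n. prefix_energy p n \<tau> k t)"
    using T by (intro sum_mono sum_mono2) auto
  also have "\<dots> = (\<Sum>t<N. \<Sum>\<tau>\<in>Pow {..<n}. \<Sum>k\<in>scales n. prefix_energy p n \<tau> k t)" by (rule sum.swap)
  also have "\<dots> = (\<Sum>t<N. \<Sum>k\<in>scales n. \<Sum>\<tau>\<in>Pow {..<n}. prefix_energy p n \<tau> k t)"
    by (rule sum.cong[OF refl sum.swap])
  also have "\<dots> = (\<Sum>t<N. \<Sum>k\<in>scales n. energy p k t)" by (simp only: sum_prefix_energy)
  also have "\<dots> = (\<Sum>k\<in>scales n. \<Sum>t<N. energy p k t)" by (rule sum.swap)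
  finally show ?thesis .
qed

text \<open>The lower bound for the left-hand side is a multiple of
  \<open>\<epsilon> powr p / \<epsilon>\<close>; so is the upper bound
  \<open>N * \<epsilon> powr p\<close> for the sum of steps, since N \<epsilon> =
  \<open>d u v\<close>. Cancelling this factor leaves a bound free of \<open>N\<close>.\<close>

lemma markov_convex_bound:
  assumes conv: "markov_convex_with C p M d" and p: "0 < p" and c: "0 < c"
  shows "real L * (c / 2 * (\<gamma> / 16) powr p) \<le> C powr p * d u v"
proof -
  \<comment> \<open>The map \<open>f\<close> must know the time to place the walker on its geodesic,
    so the state carries a clock besides the word.\<close>
  define F where "F t s w = prod_encode (Suc t, set_encode (step t (set_decode (snd (prod_decode s))) w))" for t s w
  \<comment> \<open>The value \<open>u\<close> at codes that represent no valid time and word keeps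
    the whole range in \<open>M\<close>.\<close>
  define f where "f s = (case prod_decode s of (t, m) \<Rightarrow>
    if t \<le> N \<and> set_decode m \<subseteq> {..<L} then g (set_decode m) (real t * \<epsilon>) else u)" for s
  define x0 where "x0 = prod_encode (0, 0)"
  have fin: "finite (S b t w)" for b t w by (rule finite_subset[OF S_subset]) simp
  have walk: "walk F x0 b t w = prod_encode (t, set_encode (S b t w))" for b t w
    by (induction t) (simp_all add: F_def x0_def fin)
  have f_walk: "f (walk F x0 b t w) = g (S b t w) (real t * \<epsilon>)" if "t \<le> N" for b t w
    using that by (simp add: walk f_def fin S_subset)
  have gM: "g \<sigma> (real t * \<epsilon>) \<in> M" if "\<sigma> \<subseteq> {..<L}" "t \<le> N" for \<sigma> t
    using geodesic_in[OF geodesic_g[OF that(1)] time_range[OF that(2)]] .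
  have "u \<in> M"
  proof -
    have "g {} 0 \<in> M" "g {} 0 = u"
      using geodesic_g[of "{}"] D_pos by (auto simp: geodesic_def)
    then show ?thesis by simp
  qed
  then have f: "range f \<subseteq> M" using gM by (auto simp: f_def split: prod.splits)
  define X where "X = (\<lambda>b t. walk F x0 b (min (nat t) N))"
  define A where "A k t = (\<integral>\<^sup>+w. ennreal (d (f (X N t w)) (f (X (nat (t - 2 ^ k)) t w)) powr p) \<partial>\<Omega>)
    / ennreal (2 powr (real k * p))" for k t
  define B where "B t = (\<integral>\<^sup>+w. ennreal (d (f (X N t w)) (f (X N (t - 1) w)) powr p) \<partial>\<Omega>)" for t
  have main: "(\<Sum>k. \<Sum>\<^sub>\<infinity>t. A k t) \<le> ennreal (C powr p) * (\<Sum>\<^sub>\<infinity>t. B t)"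
    unfolding A_def B_def X_def by (rule markov_convex_walk[OF conv f])
  have A: "A k (int t) = energy p k t" if "t < N" for k t
  proof -
    have "min (nat (int t)) N = t" using that by simp
    then show ?thesis unfolding A_def energy_def X_def using that by (simp add: f_walk)
  qed
  have "ennreal (real L * (c / \<epsilon> * (\<gamma> * \<epsilon> / 16) powr p / 2)) =
      (\<Sum>n<L. ennreal (c / \<epsilon> * (\<gamma> * \<epsilon> / 16) powr p / 2))"
    using c \<epsilon>_pos by (simp add: ennreal_of_nat_eq_real_of_nat flip: ennreal_mult)
  also have "\<dots> \<le> (\<Sum>n<L. \<Sum>k\<in>scales n. \<Sum>t<N. energy p k t)"
    by (intro sum_mono level_energy_ge p c) simp
  also have "\<dots> = (\<Sum>k\<in>(\<Union>n<L. scales n). \<Sum>t<N. energy p k t)"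
    by (rule sum.UNION_disjoint[symmetric]) (simp_all add: finite_scales scales_disjoint)
  also have "\<dots> \<le> (\<Sum>k\<in>(\<Union>n<L. scales n). \<Sum>\<^sub>\<infinity>t. A k t)"
  proof (rule sum_mono)
    fix k
    have "(\<Sum>t<N. energy p k t) = (\<Sum>t\<in>int ` {..<N}. A k t)"
      by (subst sum.reindex) (simp_all add: A)
    also have "\<dots> \<le> (\<Sum>\<^sub>\<infinity>t. A k t)"
      by (subst nonneg_infsum_complete) (simp_all add: SUP_upper)
    finally show "(\<Sum>t<N. energy p k t) \<le> (\<Sum>\<^sub>\<infinity>t. A k t)" .
  qed
  also have "\<dots> \<le> (\<Sum>k. \<Sum>\<^sub>\<infinity>t. A k t)"
    by (rule sum_le_suminf) (simp_all add: finite_scales)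
  also note main
  also have "(\<Sum>\<^sub>\<infinity>t. B t) \<le> ennreal (real N * \<epsilon> powr p)"
  proof -
    have B0: "B t = 0" if "t \<notin> {1..int N}" for t
    proof -
      have "min (nat t) N = min (nat (t - 1)) N" using that by auto
      then have "X N t w = X N (t - 1) w" for w by (simp add: X_def)
      moreover have "f s \<in> M" for s using f by auto
      ultimately show ?thesis by (simp add: B_def)
    qed
    have B1: "B t \<le> ennreal (\<epsilon> powr p)" if "t \<in> {1..int N}" for t
    proof -
      define r where "r = nat (t - 1)"
      have r: "min (nat t) N = Suc r" "min (nat (t - 1)) N = r" "r < N" using that by (auto simp: r_def)
      have "B t \<le> (\<integral>\<^sup>+w. ennreal (\<epsilon> powr p) \<partial>\<Omega>)"
        unfolding B_def
      proof (intro nn_integral_mono ennreal_leI powr_mono2)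
        show "d (f (X N t w)) (f (X N (t - 1) w)) \<le> \<epsilon>" for w
          using walk_step_dist[OF r(3), of N w] r(3) unfolding X_def r by (simp only: f_walk Suc_le_eq less_imp_le)
      qed (use p in auto)
      then show ?thesis by (simp add: measure_pmf.emeasure_space_1)
    qed
    have "(\<Sum>\<^sub>\<infinity>t. B t) = (\<Sum>\<^sub>\<infinity>t\<in>{1..int N}. B t)"
      by (rule infsum_cong_neutral) (use B0 in auto)
    also have "\<dots> = (\<Sum>t\<in>{1..int N}. B t)" by simp
    also have "\<dots> \<le> (\<Sum>t\<in>{1..int N}. ennreal (\<epsilon> powr p))" by (rule sum_mono[OF B1])
    also have "\<dots> = ennreal (real N * \<epsilon> powr p)"
      by (simp add: ennreal_of_nat_eq_real_of_nat flip: ennreal_mult)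
    finally show ?thesis .
  qed
  then have "ennreal (C powr p) * (\<Sum>\<^sub>\<infinity>t. B t) \<le> ennreal (C powr p * (real N * \<epsilon> powr p))"
    by (simp add: ennreal_mult mult_left_mono)
  finally have "real L * (c / \<epsilon> * (\<gamma> * \<epsilon> / 16) powr p / 2) \<le> C powr p * (real N * \<epsilon> powr p)"
    by (simp add: ennreal_le_iff)
  moreover have "(\<gamma> * \<epsilon> / 16) powr p = (\<gamma> / 16) powr p * \<epsilon> powr p"
    using \<gamma>_pos \<epsilon>_pos by (simp flip: powr_mult)
  ultimately have "(real L * (c / 2 * (\<gamma> / 16) powr p)) * (\<epsilon> powr p / \<epsilon>) \<le> (C powr p * d u v) * (\<epsilon> powr p / \<epsilon>)"
    using N_pos D_pos by (simp add: \<epsilon>_def mult_ac)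
  then show ?thesis by (rule mult_right_le_imp_le) (use \<epsilon>_pos in simp)
qed

end

theorem theorem1p5:
  fixes M :: "'a set" and d :: "'a \<Rightarrow> 'a \<Rightarrow> real" and p :: real
  assumes "Metric_space M d"
    and "contains_thick_family M d"
    and "p > 0"
  shows "\<not> markov_convex p M d"
proof
  assume "markov_convex p M d"
  then have "{C. C \<ge> 0 \<and> markov_convex_with C p M d} \<noteq> {}"
    unfolding markov_convex_def markov_convexity_constant_def by (metis Inf_empty image_empty infinity_ennreal_def less_irrefl)
  then obtain C where C: "markov_convex_with C p M d" by auto
  interpret Metric_space M d by fact
  obtain u v T where thick: "thick_family M d u v T"
    using assms(2) unfolding contains_thick_family_def by auto
  obtain \<gamma> c where pos: "0 < \<gamma>" "0 < c"
    and tree: "\<And>L. \<exists>g Q lo mesh. geodesic_tree M d u v \<gamma> c L g Q lo mesh"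
  proof (rule geodesic_tree_exists[OF thick], goal_cases)
    case (1 \<gamma> c)
    from 1(2-) show ?case by (rule 1(1))
  qed
  define \<eta> where "\<eta> = c / 2 * (\<gamma> / 16) powr p"
  have \<eta>: "0 < \<eta>" using pos by (simp add: \<eta>_def)
  \<comment> \<open>The depth is fixed first: the thresholds \<open>lo n\<close>, and hence the
    number \<open>N\<close> of time steps, depend on the tree of that depth.\<close>
  obtain L :: nat where L: "C powr p * d u v < real L * \<eta>"
    using reals_Archimedean3[OF \<eta>] by auto
  obtain g Q lo mesh where "geodesic_tree M d u v \<gamma> c L g Q lo mesh"
    using tree[of L] by auto
  then interpret geodesic_tree M d u v \<gamma> c L g Q lo mesh .
  obtain l where l: "0 < l" "\<And>n. n < L \<Longrightarrow> l \<le> lo n"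
  proof
    show "0 < Min (insert 1 (lo ` {..<L}))" using lo_pos by (subst Min_gr_iff) auto
    show "Min (insert 1 (lo ` {..<L})) \<le> lo n" if "n < L" for n using that by (intro Min_le) auto
  qed
  obtain N :: nat where N: "0 < N" "d u v < real N * l"
  proof -
    obtain N where "d u v < real N * l" using reals_Archimedean3[OF l(1)] by auto
    moreover from this have "N \<noteq> 0" using D_pos by (intro notI) simp
    ultimately show ?thesis using that by blast
  qed
  interpret tree_walk M d u v \<gamma> c L g Q lo mesh N
  proof
    show "d u v / real N \<le> lo n" if "n < L" for n
    proof -
      have "d u v / real N \<le> l" using N by (simp add: pos_divide_le_eq mult.commute)
      then show ?thesis using l(2)[OF that] by simp
    qed
  qed (rule N)
  show False using markov_convex_bound[OF C assms(3) pos(2)] L by (simp add: \<eta>_def)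
qed

end
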